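(* There exists a positive constant $A$ such that for every natural number $n=\prod_{k=1}^{m}q_k^{\alpha_k}$, where $m\ge1$, $q_1<q_2<\cdots<q_m$ are primes and $\alpha_k\ge 2$ is an integer for each $k=1,\dots,m$, if $n\ge A$ then $$e^{\gamma}n\log\log n-\sigma(n)>0.$$
   Context: $\sigma(n)=\sum_{d\mid n}d$ is the sum-of-divisors function, $\gamma$ is Euler's constant, and $\log$ is the natural logarithm. *)

theory Defs
  imports "HOL-Analysis.Analysis" "HOL-Computational_Algebra.Primes"
begin

definition sigma_div :: "nat \<Rightarrow> nat" where
  "sigma_div n = (\<Sum>d | d dvd n. d)"

end

theory Submission
  imports Defs "HOL-Number_Theory.Prime_Powers" "HOL-Real_Asymp.Real_Asymp"
begin

text \<open>
  If every exponent in \<open>n = \<Prod> q\<^sub>k ^ \<alpha>\<^sub>k\<close> is at least 2, then the primes dividing \<open>n\<close> satisfy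
  \<open>\<Sum> log q\<^sub>k \<le> (log n) / 2\<close>, while \<open>log (\<sigma>(n) / n)\<close> is at most the sum of \<open>- log (1 - 1 / q\<^sub>k)\<close>.
  Under such a constraint the latter sum is largest for the primes up to about
  \<open>N = (log n) / 2\<close>. With the Lagrange multiplier \<open>\<lambda> = 1 / (N log N)\<close> this becomes
  \<open>log (\<sigma>(n) / n) \<le> (\<Sum>p\<le>N. - log (1 - 1 / p) - \<lambda> log p) + \<lambda> (log n) / 2\<close>
  (lemma \<open>sum_over_primes_upper\<close>), and it has to be compared with
  \<open>\<gamma> + log log log n\<close>, which is \<open>\<gamma> + log log N + (log 2) / log N\<close> up to smaller terms.
  So the factor 1/2 is worth \<open>(log 2) / log N\<close>, and Mertens' product must be bounded with an
  error term of that order with a constant below \<open>log 2\<close>.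

  The prime number theorem would give this at once, but it is avoidable, because
  the term \<open>- \<lambda> \<Sum> log p\<close> cancels the unknown fluctuation of the primes. Write \<open>\<Lambda>\<close> for the von Mangoldt
  function, \<open>\<psi>(N) = \<Sum> \<Lambda>(n)\<close>, \<open>M(N) = \<Sum> \<Lambda>(n) / n\<close> and \<open>S(N) = \<Sum> \<Lambda>(n) / (n log n)\<close>, the sums being over
  \<open>n \<le> N\<close>. Up to \<open>o(1 / log N)\<close> the sum over \<open>p \<le> N\<close> above is at most \<open>S(N) - \<psi>(N) / (N log N)\<close>
  (lemma \<open>mertens_product_vs_mertens2\<close>). Partial summation from \<open>\<integral> M(t) / t\<close>, whose
  asymptotics are elementary, gives
  \<open>S(N) = log log N + C + (M(N) - log N + \<gamma>) / log N + O(1 / log\<^sup>2 N)\<close>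
  (lemma \<open>mertens2_asymptotics\<close>), comparison with the zeta function near 1 gives \<open>C \<le> \<gamma>\<close>
  (lemma \<open>mertens_constant_le\<close>), and the trivial estimate of \<open>log N!\<close> gives
  \<open>M(N) - \<psi>(N) / N \<le> log N - 1 + o(1)\<close> (lemma \<open>mertens1_upper\<close>). Altogether
  \<open>S(N) - \<psi>(N) / (N log N) \<le> log log N + \<gamma> + (\<gamma> - 1 + o(1)) / log N\<close>. Adding
  \<open>\<lambda> (log n) / 2\<close>, which is \<open>(1 + o(1)) / log N\<close>, leaves \<open>(\<gamma> + o(1)) / log N\<close> to be compared with
  \<open>(log 2) / log N\<close>, and \<open>\<gamma> < 13/22 < 2/3 \<le> log 2\<close>.
\<close>

section \<open>Sums of the von Mangoldt function\<close>

abbreviation Lam :: "nat \<Rightarrow> real" where "Lam \<equiv> mangoldt"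

definition psi :: "nat \<Rightarrow> real" where
  "psi N = (\<Sum>n=1..N. Lam n)"

definition mertens1 :: "nat \<Rightarrow> real" where
  "mertens1 N = (\<Sum>n=1..N. Lam n / real n)"

definition mertens2 :: "nat \<Rightarrow> real" where
  "mertens2 N = (\<Sum>n=1..N. Lam n / (real n * ln (real n)))"

text \<open>This is \<open>\<integral>\<close> of \<open>mertens1 \<lfloor>t\<rfloor> / t\<close> over \<open>t\<close> from 1 to \<open>x\<close>. It is taken at real \<open>x\<close> because it is integrated
  again below.\<close>
definition mertens1_integral :: "real \<Rightarrow> real" where
  "mertens1_integral x = (\<Sum>n=1..nat \<lfloor>x\<rfloor>. Lam n / real n * ln (x / real n))"

lemma sum_over_divisors_swap:
  fixes f :: "nat \<Rightarrow> nat \<Rightarrow> real"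
  shows "(\<Sum>n=1..N. \<Sum>d | d dvd n. f d (n div d)) = (\<Sum>d=1..N. \<Sum>k=1..N div d. f d k)"
proof -
  have "(\<Sum>n=1..N. \<Sum>d | d dvd n. f d (n div d))
      = (\<Sum>(n,d)\<in>Sigma {1..N} (\<lambda>n. {d. d dvd n}). f d (n div d))"
    by (rule sum.Sigma) auto
  also have "\<dots> = (\<Sum>(d,k)\<in>Sigma {1..N} (\<lambda>d. {1..N div d}). f d k)"
  proof (rule sum.reindex_bij_witness[where i="\<lambda>(d,k). (d*k, d)" and j="\<lambda>(n,d). (d, n div d)"], goal_cases)
    case (2 a)
    then obtain n d where a: "a = (n,d)" "n \<in> {1..N}" "d dvd n" by auto
    then have "d \<le> N" "1 \<le> d" by (auto dest: dvd_imp_le intro: Suc_leI dvd_pos_nat)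
    moreover have "1 \<le> n div d" using a by (auto simp: Suc_le_eq div_greater_zero_iff dvd_imp_le intro: dvd_pos_nat)
    moreover have "n div d \<le> N div d" using a by (auto intro: div_le_mono)
    ultimately show ?case using a by auto
  next
    case (4 a)
    then obtain d k where a: "a = (d,k)" "d \<in> {1..N}" "k \<in> {1..N div d}" by auto
    then have "d * k \<le> N" by (metis atLeastAtMost_iff div_mult_self_is_m le_trans mult.commute mult_le_mono2 times_div_less_eq_dividend)
    then show ?case using a by auto
  qed auto
  also have "\<dots> = (\<Sum>d=1..N. \<Sum>k=1..N div d. f d k)"
    by (rule sum.Sigma[symmetric]) auto
  finally show ?thesis .
qed

lemma ln_fact_eq: "ln (fact N :: real) = (\<Sum>d=1..N. Lam d * real (N div d))"
proof -
  have "ln (fact N :: real) = (\<Sum>n=1..N. ln (real n))"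
    by (induction N) (auto simp: ln_mult)
  also have "\<dots> = (\<Sum>n=1..N. \<Sum>d | d dvd n. Lam d)"
    by (intro sum.cong) (auto simp: mangoldt_sum)
  also have "\<dots> = (\<Sum>d=1..N. \<Sum>k=1..N div d. Lam d)"
    by (rule sum_over_divisors_swap)
  finally show ?thesis by (simp add: mult.commute)
qed

text \<open>Chebyshev's argument: \<open>\<lfloor>2N / d\<rfloor> - 2 \<lfloor>N / d\<rfloor>\<close> is nonnegative, and it is 1 for \<open>N < d \<le> 2N\<close>, so the
  increment of \<open>psi\<close> is at most the logarithm of the central binomial coefficient.\<close>
lemma psi_double: "psi (2 * N) \<le> psi N + 2 * real N * ln 2"
proof -
  have "psi (2*N) - psi N = (\<Sum>d\<in>{1..2*N}-{1..N}. Lam d)"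
    unfolding psi_def by (subst sum_diff) auto
  also have "\<dots> \<le> (\<Sum>d\<in>{1..2*N}-{1..N}. Lam d * (real ((2*N) div d) - 2 * real (N div d)))"
  proof (rule sum_mono)
    fix d assume d: "d \<in> {1..2*N}-{1..N}"
    then have "N div d = 0" "(2*N) div d \<ge> 1"
      by (auto simp: Suc_le_eq div_greater_zero_iff)
    then show "Lam d \<le> Lam d * (real ((2*N) div d) - 2 * real (N div d))"
      using mult_left_mono[of 1 "real ((2*N) div d)" "Lam d"] by (simp add: mangoldt_nonneg)
  qed
  also have "\<dots> \<le> (\<Sum>d\<in>{1..2*N}. Lam d * (real ((2*N) div d) - 2 * real (N div d)))"
  proof (rule sum_mono2)
    fix d assume d: "d \<in> {1..2*N} - ({1..2*N}-{1..N})"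
    have "2 * (N div d) \<le> (2*N) div d" 
      using d by (auto simp: less_eq_div_iff_mult_less_eq)
    then have "2 * real (N div d) \<le> real ((2*N) div d)"
      by (metis of_nat_le_iff of_nat_mult of_nat_numeral)
    then show "0 \<le> Lam d * (real ((2*N) div d) - 2 * real (N div d))"
      by (simp add: mangoldt_nonneg)
  qed auto
  also have "\<dots> = (\<Sum>d=1..2*N. Lam d * real ((2*N) div d)) - 2 * (\<Sum>d=1..2*N. Lam d * real (N div d))"
    by (simp add: right_diff_distrib sum_subtractf sum_distrib_left mult_ac)
  also have "(\<Sum>d=1..2*N. Lam d * real (N div d)) = (\<Sum>d=1..N. Lam d * real (N div d))"
    by (rule sum.mono_neutral_right) auto
  also have "(\<Sum>d=1..2*N. Lam d * real ((2*N) div d)) - 2 * (\<Sum>d=1..N. Lam d * real (N div d))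
     = ln (fact (2*N)) - 2 * ln (fact N)"
    by (simp add: ln_fact_eq)
  also have "\<dots> = ln (real ((2*N) choose N))"
    by (simp add: binomial_fact ln_div ln_mult)
  also have "\<dots> \<le> ln (real (2 ^ (2*N)))"
    by (subst ln_le_cancel_iff) (auto simp: binomial_le_pow2 simp del: of_nat_power)
  also have "\<dots> = 2 * real N * ln 2" by (simp add: ln_realpow)
  finally show ?thesis by simp
qed

lemma psi_le: "psi N \<le> 4 * real N"
proof (induction N rule: less_induct)
  case (less N)
  show ?case
  proof (cases "N = 0")
    case False
    define K where "K = N div 2"
    have K: "psi K \<le> 4 * real K" using less[of K] False by (simp add: K_def)
    have "2 * real K * ln 2 \<le> 2 * real K * 1"
      by (intro mult_left_mono) (use ln_2_less_1 in auto)
    then have 2: "psi (2*K) \<le> 6 * real K" using psi_double[of K] K by linarith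
    consider "N = 2*K" | "N = Suc (2*K)" unfolding K_def by linarith
    then show ?thesis
    proof cases
      case 2
      have "psi N = psi (2*K) + Lam N" unfolding 2 psi_def by simp
      also have "Lam N \<le> ln N" using False by (intro mangoldt_le) auto
      also have "ln N \<le> real N - 1" using False by (intro ln_le_minus_one) auto
      finally show ?thesis using \<open>psi (2*K) \<le> 6 * real K\<close> 2 by simp
    qed (use 2 in simp)
  qed (simp add: psi_def)
qed

lemma ln_fact_bounds:
  assumes "N \<ge> 1"
  shows "real N * ln N - real N \<le> ln (fact N)" 
    and "ln (fact N) \<le> real N * ln N - real N + 1 + ln N"
proof -
  have "real N * ln N - real N \<le> ln (fact N) \<and> ln (fact N) \<le> real N * ln N - real N + 1 + ln N"
    using assms
  proof (induction N rule: dec_induct)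
    case (step n)
    have n: "real n > 0" using step by simp
    have a: "ln (1 + real n) - ln n \<le> 1 / real n"
      using ln_diff_le_inverse[of "real n"] step by (simp add: add_ac)
    have "ln (real n / (1 + real n)) \<le> real n / (1 + real n) - 1"
      using n by (intro ln_le_minus_one) auto
    then have b: "ln (1 + real n) - ln n \<ge> 1 / (1 + real n)"
      using n by (simp add: ln_div field_simps)
    have a': "real n * ln (1 + real n) - real n * ln n \<le> 1" 
      using mult_left_mono[OF a, of "real n"] n by (simp add: algebra_simps)
    have b': "(1 + real n) * ln (1 + real n) - (1 + real n) * ln n \<ge> 1" 
      using mult_left_mono[OF b, of "1 + real n"] n by (simp add: algebra_simps)
    have f: "ln (fact (Suc n)) = ln (1 + real n) + ln (fact n :: real)"
      using n by (simp add: ln_mult)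
    show ?case unfolding f using step a' b' by (simp add: algebra_simps)
  qed simp
  then show "real N * ln N - real N \<le> ln (fact N)" 
    "ln (fact N) \<le> real N * ln N - real N + 1 + ln N" by auto
qed

lemma real_div_bounds:
  fixes N d :: nat
  assumes "d > 0"
  shows "real (N div d) \<le> real N / real d" "real N / real d \<le> real (N div d) + 1"
proof -
  have "real N = real d * real (N div d) + real (N mod d)"
    by (metis mult_div_mod_eq of_nat_add of_nat_mult)
  moreover have "real (N mod d) \<le> real d" using assms by (simp add: less_imp_le)
  ultimately show "real (N div d) \<le> real N / real d" "real N / real d \<le> real (N div d) + 1"
    using assms by (auto simp: field_simps)
qed

lemma mertens1_lower: assumes "N \<ge> 1" shows "mertens1 N \<ge> ln N - 1"
proof -
  have "real N * ln N - real N \<le> (\<Sum>d=1..N. Lam d * real (N div d))"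
    using ln_fact_bounds[OF assms] ln_fact_eq by simp
  also have "\<dots> \<le> (\<Sum>d=1..N. Lam d * (real N / real d))"
    by (intro sum_mono mult_left_mono real_div_bounds) (auto simp: mangoldt_nonneg)
  also have "\<dots> = real N * mertens1 N" by (simp add: mertens1_def sum_distrib_left mult_ac)
  finally have "real N * (ln N - 1) \<le> real N * mertens1 N" by (simp add: algebra_simps)
  then show ?thesis using assms by simp
qed

text \<open>Only \<open>\<lfloor>N / d\<rfloor> \<ge> N / d - 1\<close> is used in the formula for \<open>log N!\<close>. The loss is exactly \<open>psi N\<close>, which is
  kept rather than estimated: in the end it cancels against a sum of \<open>log p\<close> over primes.\<close>
lemma mertens1_upper: 
  assumes "N \<ge> 1" shows "mertens1 N \<le> ln N - 1 + psi N / N + (1 + ln N) / N"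
proof -
  have "real N * mertens1 N - psi N = (\<Sum>d=1..N. Lam d * (real N / real d - 1))"
    by (simp add: mertens1_def psi_def sum_distrib_left mult_ac right_diff_distrib sum_subtractf)
  also have "\<dots> \<le> (\<Sum>d=1..N. Lam d * real (N div d))"
  proof (intro sum_mono mult_left_mono)
    fix d assume "d \<in> {1..N}"
    show "real N / real d - 1 \<le> real (N div d)"
      using real_div_bounds(2)[of d N] \<open>d \<in> {1..N}\<close> by simp
  qed (auto simp: mangoldt_nonneg)
  also have "\<dots> \<le> real N * ln N - real N + 1 + ln N"
    using ln_fact_bounds[OF assms] ln_fact_eq by simp
  finally have "real N * mertens1 N \<le> real N * ln N - real N + psi N + (1 + ln N)" by simp
  also have "\<dots> = real N * (ln N - 1 + psi N / N + (1 + ln N) / N)"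
  proof -
    have "real N * (psi N / N) = psi N" "real N * ((1 + ln N) / N) = 1 + ln N"
      using assms by auto
    then show ?thesis by (simp only: distrib_left right_diff_distrib mult_1_right)
  qed
  finally show ?thesis using assms by simp
qed

lemma mertens1_minus_ln_bounded: assumes "N \<ge> 1" shows "\<bar>mertens1 N - ln N\<bar> \<le> 4"
proof -
  have "psi N / N \<le> 4" using psi_le[of N] assms by (simp add: field_simps)
  moreover have "(1 + ln N) / N \<le> 1" using ln_le_minus_one[of "real N"] assms by (simp add: field_simps)
  ultimately show ?thesis using mertens1_upper[OF assms] mertens1_lower[OF assms] by linarith
qed

section \<open>The average of the first Mertens sum\<close>

lemma harm_minus_ln_bound:
  assumes "k \<ge> 1" "real k \<le> y" "y < real k + 1"
  shows "\<bar>harm k - ln y - euler_mascheroni\<bar> \<le> 4 / y"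
proof -
  define t where "t = harm k - ln (real (Suc k))"
  have k: "real k \<ge> 1" "y > 0" using assms by auto
  have 1: "t \<le> euler_mascheroni" "euler_mascheroni \<le> t + 1 / (2 * real k)"
    using euler_mascheroni_bounds[OF assms(1)] k by (auto simp: t_def field_simps intro: order.trans[rotated])
  have 2: "ln (real (Suc k)) - ln (real k) \<le> 1 / real k" 
    using ln_diff_le_inverse[of "real k"] k by (simp add: add_ac)
  have 3: "ln (real k) \<le> ln y" using assms k by (subst ln_le_cancel_iff) auto
  have 4: "ln y \<le> ln (real (Suc k))" using assms k by (subst ln_le_cancel_iff) auto
  have "\<bar>harm k - ln y - euler_mascheroni\<bar> \<le> 2 / real k"
    using 1 2 3 4 unfolding t_def by (simp add: abs_le_iff field_simps)
  also have "\<dots> \<le> 4 / y" using assms k by (simp add: field_simps)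
  finally show ?thesis .
qed

text \<open>The mean value theorem for \<open>(log t)\<^sup>2 / 2\<close>, with \<open>log t / t\<close> decreasing for \<open>t \<ge> e\<close>.\<close>
lemma half_ln_squared_step:
  fixes m :: real
  assumes "m \<ge> 3"
  shows "ln (m + 1) / (m + 1) \<le> (ln (m + 1))\<^sup>2 / 2 - (ln m)\<^sup>2 / 2"
    and "(ln (m + 1))\<^sup>2 / 2 - (ln m)\<^sup>2 / 2 \<le> ln m / m"
proof -
  have "\<exists>z>m. z < m + 1 \<and> (ln (m + 1))\<^sup>2 / 2 - (ln m)\<^sup>2 / 2 = (m + 1 - m) * (ln z / z)"
    using assms by (intro MVT2) (auto intro!: derivative_eq_intros simp: field_simps)
  then obtain z where z: "m < z" "z < m + 1" "(ln (m + 1))\<^sup>2 / 2 - (ln m)\<^sup>2 / 2 = ln z / z"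
    by auto
  have "exp 1 \<le> m" using exp_le assms by linarith
  then show "ln (m + 1) / (m + 1) \<le> (ln (m + 1))\<^sup>2 / 2 - (ln m)\<^sup>2 / 2"
    "(ln (m + 1))\<^sup>2 / 2 - (ln m)\<^sup>2 / 2 \<le> ln m / m"
    unfolding z(3) using z by (auto intro!: ln_x_over_x_mono)
qed

lemma sum_ln_over_id:
  "\<exists>c. \<forall>N\<ge>1. \<bar>(\<Sum>m=1..N. ln (real m) / real m) - (ln (real N))\<^sup>2 / 2\<bar> \<le> c"
proof -
  define T where "T = (\<lambda>N. \<Sum>m=1..N. ln (real m) / real m)"
  define D where "D = (\<lambda>N. T N - (ln (real N))\<^sup>2 / 2)"
  \<comment> \<open>From 3 on, \<open>D N\<close> decreases, while \<open>T N - (log (N + 1))\<^sup>2 / 2\<close> increases from the value \<open>c0\<close>.\<close>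
  define c0 where "c0 = T 3 - (ln 4)\<^sup>2 / 2"
  have up: "D N \<le> D 3" if "N \<ge> 3" for N
    using that
  proof (induction N rule: dec_induct)
    case (step n)
    show ?case using half_ln_squared_step(1)[of "real n"] step by (simp add: D_def T_def add_ac)
  qed simp
  have lo': "T N - (ln (real N + 1))\<^sup>2 / 2 \<ge> c0" if "N \<ge> 3" for N
    using that
  proof (induction N rule: dec_induct)
    case (step n)
    show ?case using half_ln_squared_step(2)[of "real n + 1"] step 
      by (simp add: T_def add_ac)
  qed (simp add: c0_def)
  have lo: "D N \<ge> c0" if "N \<ge> 3" for N
  proof -
    have "(ln (real N))\<^sup>2 \<le> (ln (real N + 1))\<^sup>2" using that by (intro power_mono) auto
    then show ?thesis using lo'[OF that] by (simp add: D_def)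
  qed
  have "\<bar>D N\<bar> \<le> \<bar>D 1\<bar> + \<bar>D 2\<bar> + \<bar>D 3\<bar> + \<bar>c0\<bar>" if N: "N \<ge> 1" for N
  proof -
    consider "N = 1" | "N = 2" | "N \<ge> 3" using N by linarith
    then show ?thesis
    proof cases
      case 3
      then show ?thesis using up[of N] lo[of N] by linarith
    qed auto
  qed
  then show ?thesis unfolding D_def T_def by blast
qed

text \<open>Summing \<open>\<Lambda> * 1 = log\<close> with weight \<open>1 / m\<close>: the harmonic numbers on the right bring in Euler's constant.\<close>
lemma sum_ln_over_id_eq:
  "(\<Sum>m=1..N. ln (real m) / real m) = (\<Sum>d=1..N. Lam d / real d * harm (N div d))"
proof -
  have "(\<Sum>m=1..N. ln (real m) / real m) = (\<Sum>m=1..N. \<Sum>d | d dvd m. Lam d / real d * inverse (real (m div d)))"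
  proof (rule sum.cong[OF refl])
    fix m assume m: "m \<in> {1..N}"
    have "ln (real m) / real m = (\<Sum>d | d dvd m. Lam d / real m)"
      using m mangoldt_sum[of m, where 'a=real] by (simp add: sum_divide_distrib[symmetric])
    also have "\<dots> = (\<Sum>d | d dvd m. Lam d / real d * inverse (real (m div d)))"
      using m by (intro sum.cong) (auto simp: real_of_nat_div field_simps)
    finally show "ln (real m) / real m = \<dots>" .
  qed
  also have "\<dots> = (\<Sum>d=1..N. \<Sum>k=1..N div d. Lam d / real d * inverse (real k))"
    by (rule sum_over_divisors_swap)
  also have "\<dots> = (\<Sum>d=1..N. Lam d / real d * harm (N div d))"
    by (simp add: harm_def sum_distrib_left)
  finally show ?thesis .
qed

text \<open>Bounds for passing between a real argument and its integer part.\<close>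
lemma nat_floor_facts:
  fixes x :: real
  assumes "x \<ge> 1"
  shows "nat \<lfloor>x\<rfloor> \<ge> 1" "real (nat \<lfloor>x\<rfloor>) \<le> x" "x < real (nat \<lfloor>x\<rfloor>) + 1"
    "ln (real (nat \<lfloor>x\<rfloor>)) \<le> ln x" "ln x \<le> ln (real (nat \<lfloor>x\<rfloor>)) + 1 / real (nat \<lfloor>x\<rfloor>)"
proof -
  define N where "N = nat \<lfloor>x\<rfloor>"
  have N: "N \<ge> 1" "real N \<le> x" "x < real N + 1" using assms unfolding N_def by linarith+
  moreover have "ln N \<le> ln x" using N by (subst ln_le_cancel_iff) auto
  moreover have "ln x \<le> ln (real N + 1)" using N by (subst ln_le_cancel_iff) auto
  moreover have "ln (real N + 1) - ln N < 1 / N" using N by (intro ln_diff_le_inverse) auto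
  ultimately show "nat \<lfloor>x\<rfloor> \<ge> 1" "real (nat \<lfloor>x\<rfloor>) \<le> x" "x < real (nat \<lfloor>x\<rfloor>) + 1"
    "ln (real (nat \<lfloor>x\<rfloor>)) \<le> ln x" "ln x \<le> ln (real (nat \<lfloor>x\<rfloor>)) + 1 / real (nat \<lfloor>x\<rfloor>)"
    unfolding N_def by linarith+
qed

text \<open>On average \<open>mertens1\<close> is \<open>log t - \<gamma>\<close>, with no information on primes beyond Chebyshev's bound. In
  \<open>\<Sum> log m / m = \<Sum> \<Lambda>(d) / d * harm (N div d)\<close> each harmonic number is
  \<open>log (x / d) + \<gamma> + O(d / x)\<close>; the main term sums to \<open>mertens1_integral x + \<gamma> * mertens1 N\<close>,
  and the errors sum to \<open>O(psi N / x) = O(1)\<close>.\<close>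
lemma mertens1_integral_asymptotics:
  "\<exists>B. \<forall>x\<ge>1. \<bar>mertens1_integral x - ((ln x)\<^sup>2 / 2 - euler_mascheroni * ln x)\<bar> \<le> B"
proof -
  obtain c where c: "\<And>N. N \<ge> 1 \<Longrightarrow> \<bar>(\<Sum>m=1..N. ln (real m) / real m) - (ln (real N))\<^sup>2 / 2\<bar> \<le> c"
    using sum_ln_over_id by blast
  define g :: real where "g = euler_mascheroni"
  have g: "g > 0" by (simp add: g_def euler_mascheroni_pos)
  have "\<bar>mertens1_integral x - ((ln x)\<^sup>2 / 2 - g * ln x)\<bar> \<le> c + 16 + 2 + 5 * g" if x: "x \<ge> 1" for x :: real
  proof -
    define N where "N = nat \<lfloor>x\<rfloor>"
    note N = nat_floor_facts[OF x, folded N_def]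
    have N0: "real N \<ge> 1" using N(1) by simp
    define T where "T = (\<Sum>m=1..N. ln (real m) / real m)"
    have "T - mertens1_integral x - g * mertens1 N = (\<Sum>d=1..N. Lam d / real d * (harm (N div d) - ln (x / real d) - g))"
      unfolding T_def sum_ln_over_id_eq mertens1_integral_def mertens1_def N_def[symmetric]
      by (simp add: right_diff_distrib sum_subtractf sum_distrib_left mult_ac)
    also have "\<bar>\<dots>\<bar> \<le> (\<Sum>d=1..N. Lam d / real d * (4 / (x / real d)))"
    proof (rule order.trans[OF sum_abs], rule sum_mono)
      fix d assume d: "d \<in> {1..N}"
      have "N div d * d \<le> N" by simp
      moreover have "N < (N div d + 1) * d" using d 
        by (metis Suc_eq_plus1 atLeastAtMost_iff dividend_less_div_times mult.commute mult_Suc_right not_one_le_zero zero_less_iff_neq_zero)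
      ultimately have "real (N div d) * real d \<le> real N" "real N + 1 \<le> (real (N div d) + 1) * real d" 
        by (metis of_nat_le_iff of_nat_mult, metis Suc_leI of_nat_Suc of_nat_le_iff of_nat_mult Suc_eq_plus1 add.commute)
      then have "real (N div d) * real d \<le> x" "x < (real (N div d) + 1) * real d" using N by linarith+
      then have "\<bar>harm (N div d) - ln (x / real d) - g\<bar> \<le> 4 / (x / real d)"
        unfolding g_def using d
        by (intro harm_minus_ln_bound) (auto simp: field_simps Suc_le_eq div_greater_zero_iff)
      then have "Lam d / real d * \<bar>harm (N div d) - ln (x / real d) - g\<bar> \<le> Lam d / real d * (4 / (x / real d))"
        by (rule mult_left_mono) (simp add: mangoldt_nonneg)
      then show "\<bar>Lam d / real d * (harm (N div d) - ln (x / real d) - g)\<bar> \<le> Lam d / real d * (4 / (x / real d))"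
        by (simp add: abs_mult mangoldt_nonneg del: times_divide_eq_left times_divide_eq_right)
    qed
    also have "\<dots> = (\<Sum>d=1..N. Lam d * (4 / x))"
      by (intro sum.cong) auto
    also have "\<dots> = 4 / x * psi N" by (simp add: psi_def sum_distrib_left sum_divide_distrib mult_ac)
    also have "\<dots> \<le> 4 / x * (4 * x)" using x psi_le[of N] N by (intro mult_left_mono) auto
    also have "\<dots> = 16" using x by simp
    finally have 1: "\<bar>T - mertens1_integral x - g * mertens1 N\<bar> \<le> 16" .
    have d1: "1 / real N \<le> 1" using N0 by simp
    then have "\<bar>mertens1 N - ln x\<bar> \<le> 5" using mertens1_minus_ln_bounded[OF N(1)] N by linarith
    then have "\<bar>g * (mertens1 N - ln x)\<bar> \<le> g * 5" using g by (simp add: abs_mult)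
    then have 2: "\<bar>g * mertens1 N - g * ln x\<bar> \<le> 5 * g" by (simp add: algebra_simps)
    have "(ln x)\<^sup>2 \<le> (ln N + 1 / N)\<^sup>2" using N x by (intro power_mono) auto
    also have "\<dots> = (ln N)\<^sup>2 + 2 * (ln N / N) + (1 / N)\<^sup>2" by (simp add: power2_sum)
    also have "ln N / N \<le> 1" using ln_le_minus_one[of "real N"] N0 by (simp add: field_simps)
    also have "(1 / N)\<^sup>2 \<le> 1" using d1 by (simp add: power_le_one_iff)
    finally have "(ln x)\<^sup>2 / 2 \<le> (ln N)\<^sup>2 / 2 + 2" by simp
    moreover have "(ln N)\<^sup>2 \<le> (ln x)\<^sup>2" using N by (intro power_mono) auto
    ultimately show ?thesis using 1 2 c[OF N(1)] unfolding T_def[symmetric] by (simp add: abs_le_iff)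
  qed
  then show ?thesis unfolding g_def by blast
qed

section \<open>Mertens' second theorem with its term of order 1/log\<close>

text \<open>Taylor's formula for \<open>1 / v\<close> expanded at \<open>u\<close> to first order, with the remainder in integral form.\<close>
lemma kernel_has_integral:
  fixes a u v :: real
  assumes "0 < a" "a \<le> v" "v \<le> u"
  shows "((\<lambda>z. 2 * max (z - v) 0 / z ^ 3) has_integral (1 / v - 1 / u - (u - v) / u\<^sup>2)) {a..u}"
proof -
  have "((\<lambda>z. 2 * max (z - v) 0 / z ^ 3) has_integral 0) {a..v}"
    by (rule has_integral_is_0) auto
  moreover have "((\<lambda>z. 2 * max (z - v) 0 / z ^ 3) has_integral
      (v / u\<^sup>2 - 2 / u) - (v / v\<^sup>2 - 2 / v)) {v..u}"
  proof (rule fundamental_theorem_of_calculus[OF assms(3)])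
    fix z assume z: "z \<in> {v..u}"
    then have "z > 0" using assms by auto
    then have "((\<lambda>z. v / z\<^sup>2 - 2 / z) has_real_derivative 2 * max (z - v) 0 / z ^ 3) (at z within {v..u})"
      using z by (auto intro!: derivative_eq_intros simp: field_simps power2_eq_square power3_eq_cube)
    then show "((\<lambda>z. v / z\<^sup>2 - 2 / z) has_vector_derivative 2 * max (z - v) 0 / z ^ 3) (at z within {v..u})"
      by (simp add: has_real_derivative_iff_has_vector_derivative)
  qed
  ultimately have "((\<lambda>z. 2 * max (z - v) 0 / z ^ 3) has_integral
      0 + ((v / u\<^sup>2 - 2 / u) - (v / v\<^sup>2 - 2 / v))) {a..u}"
    using assms by (intro has_integral_combine) auto
  moreover have "0 + ((v / u\<^sup>2 - 2 / u) - (v / v\<^sup>2 - 2 / v)) = 1 / v - 1 / u - (u - v) / u\<^sup>2"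
    using assms by (simp add: field_simps power2_eq_square)
  ultimately show ?thesis by simp
qed

text \<open>Two partial summations at once: the preceding expansion of \<open>1 / log n\<close> at \<open>u = log x\<close>, summed with
  weights \<open>\<Lambda>(n) / n\<close>. For \<open>z \<le> u\<close> the truncated terms \<open>max (z - log n) 0\<close> add up to
  \<open>mertens1_integral (exp z)\<close>.\<close>
lemma mertens2_has_integral:
  assumes "x \<ge> 2"
  defines "N \<equiv> nat \<lfloor>x\<rfloor>"
  shows "((\<lambda>z. 2 * mertens1_integral (exp z) / z ^ 3) has_integral (mertens2 N - mertens1 N / ln x - mertens1_integral x / (ln x)\<^sup>2)) {ln 2..ln x}"
proof -
  define u where "u = ln x"
  have x1: "x \<ge> 1" using assms by simp
  note N = nat_floor_facts[OF x1, folded N_def]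
  have "((\<lambda>z. \<Sum>n=1..N. Lam n / real n * (2 * max (z - ln (real n)) 0 / z ^ 3)) has_integral
        (\<Sum>n=1..N. Lam n / real n * (1 / ln (real n) - 1 / u - (u - ln (real n)) / u\<^sup>2))) {ln 2..u}"
  proof (rule has_integral_sum)
    fix n assume n: "n \<in> {1..N}"
    show "((\<lambda>z. Lam n / real n * (2 * max (z - ln (real n)) 0 / z ^ 3)) has_integral
        Lam n / real n * (1 / ln (real n) - 1 / u - (u - ln (real n)) / u\<^sup>2)) {ln 2..u}"
    proof (cases "n = 1")
      case False
      then have "real n \<ge> 2" "real n \<le> x" using n N by auto
      then show ?thesis unfolding u_def
        by (intro has_integral_mult_right kernel_has_integral) auto
    qed auto
  qed auto
  also have "(\<Sum>n=1..N. Lam n / real n * (1 / ln (real n) - 1 / u - (u - ln (real n)) / u\<^sup>2))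
     = mertens2 N - mertens1 N / u - mertens1_integral x / u\<^sup>2"
  proof -
    have "mertens1_integral x = (\<Sum>n=1..N. Lam n / real n * (u - ln (real n)))"
      unfolding mertens1_integral_def N_def[symmetric] u_def using assms by (intro sum.cong) (auto simp: ln_div)
    moreover have "(\<Sum>n=1..N. Lam n / real n * (1 / ln (real n) - 1 / u - (u - ln (real n)) / u\<^sup>2))
      = (\<Sum>n=1..N. Lam n / (real n * ln (real n)) - Lam n / real n / u - Lam n / real n * (u - ln (real n)) / u\<^sup>2)"
      by (intro sum.cong) (simp_all add: algebra_simps)
    ultimately show ?thesis unfolding mertens2_def mertens1_def
      by (simp only: sum_subtractf sum_divide_distrib[symmetric])
  qed
  finally have *: "((\<lambda>z. \<Sum>n=1..N. Lam n / real n * (2 * max (z - ln (real n)) 0 / z ^ 3)) has_integral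
     (mertens2 N - mertens1 N / u - mertens1_integral x / u\<^sup>2)) {ln 2..u}" .
  show ?thesis unfolding u_def[symmetric]
  proof (rule has_integral_eq[OF _ *])
    fix z assume z: "z \<in> {ln 2..u}"
    define K where "K = nat \<lfloor>exp z\<rfloor>"
    have "exp z \<le> x" using z assms unfolding u_def by (subst ln_ge_iff[symmetric]) auto
    then have "K \<le> N" unfolding K_def N_def by (intro nat_mono floor_mono)
    have "(\<Sum>n=1..N. Lam n / real n * (2 * max (z - ln (real n)) 0 / z ^ 3))
        = (\<Sum>n=1..K. Lam n / real n * (2 * max (z - ln (real n)) 0 / z ^ 3))"
    proof (rule sum.mono_neutral_right)
      show "\<forall>n\<in>{1..N} - {1..K}. Lam n / real n * (2 * max (z - ln (real n)) 0 / z ^ 3) = 0"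
      proof
        fix n assume "n \<in> {1..N} - {1..K}"
        then have "n > K" by auto
        then have "exp z < real n" unfolding K_def by linarith
        then have "z < ln (real n)" 
          by (metis exp_gt_zero less_trans ln_exp ln_less_cancel_iff)
        then show "Lam n / real n * (2 * max (z - ln (real n)) 0 / z ^ 3) = 0" by simp
      qed
    qed (use \<open>K \<le> N\<close> in auto)
    also have "\<dots> = (\<Sum>n=1..K. 2 / z ^ 3 * (Lam n / real n * ln (exp z / real n)))"
    proof (rule sum.cong[OF refl])
      fix n assume n: "n \<in> {1..K}"
      then have "real n \<le> exp z" unfolding K_def
        by (metis atLeastAtMost_iff exp_ge_zero le_nat_floor nat_floor_neg of_nat_le_iff of_nat_floor order_trans)
      then have "ln (real n) \<le> z" using n 
        by (metis atLeastAtMost_iff ln_exp ln_le_cancel_iff exp_gt_zero of_nat_0_less_iff less_le_trans zero_less_one)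
      then show "Lam n / real n * (2 * max (z - ln (real n)) 0 / z ^ 3) = 2 / z ^ 3 * (Lam n / real n * ln (exp z / real n))"
      proof -
        define t where "t = z - ln (real n)"
        have "max (z - ln (real n)) 0 = t" using \<open>ln (real n) \<le> z\<close> by (simp add: t_def)
        moreover have "ln (exp z / real n) = t" using n by (simp add: ln_div t_def)
        ultimately show ?thesis by (simp add: mult_ac)
      qed
    qed
    also have "\<dots> = 2 / z ^ 3 * mertens1_integral (exp z)"
      unfolding mertens1_integral_def K_def by (simp only: sum_distrib_left)
    finally show "(\<Sum>n=1..N. Lam n / real n * (2 * max (z - ln (real n)) 0 / z ^ 3)) = 2 * mertens1_integral (exp z) / z ^ 3"
      by simp
  qed
qed

text \<open>The integral of \<open>2 B / z ^ 3\<close> over \<open>z \<ge> u\<close> is \<open>B / u\<^sup>2\<close>; so the improper integral of \<open>f\<close> converges with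
  this rate.\<close>
lemma limit_of_has_integral_cubic_bound:
  fixes f F :: "real \<Rightarrow> real"
  assumes a: "a > 0"
    and int: "\<And>u. u \<ge> a \<Longrightarrow> (f has_integral F u) {a..u}"
    and bd: "\<And>z. z \<ge> a \<Longrightarrow> \<bar>f z\<bar> \<le> 2 * B / z ^ 3"
  shows "\<exists>L. \<forall>u\<ge>a. \<bar>F u - L\<bar> \<le> B / u\<^sup>2"
proof -
  have "2 * B / a ^ 3 \<ge> 0" using bd[of a] by linarith
  then have B0: "B \<ge> 0" using a by (simp add: zero_le_divide_iff)
  have diff: "\<bar>F u' - F u\<bar> \<le> B / u\<^sup>2" if u: "a \<le> u" "u \<le> u'" for u u'
  proof -
    have "f integrable_on {a..u'}" using int[of u'] u by (auto simp: integrable_on_def)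
    then have "f integrable_on {u..u'}" by (rule integrable_on_subinterval) (use u in auto)
    then obtain I where I: "(f has_integral I) {u..u'}" by (auto simp: integrable_on_def)
    have "(f has_integral F u + I) {a..u'}"
      using has_integral_combine[OF u int[OF u(1)] I] .
    then have I': "F u' = F u + I" using int[of u'] u by (auto dest: has_integral_unique)
    have "((\<lambda>z. 2 * B / z ^ 3) has_integral (- B / u'\<^sup>2) - (- B / u\<^sup>2)) {u..u'}"
    proof (rule fundamental_theorem_of_calculus[OF u(2)])
      fix z assume z: "z \<in> {u..u'}"
      then have "z > 0" using a u by auto
      then have "((\<lambda>z. - B / z\<^sup>2) has_real_derivative 2 * B / z ^ 3) (at z within {u..u'})"
        using z by (auto intro!: derivative_eq_intros simp: field_simps power2_eq_square power3_eq_cube)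
      then show "((\<lambda>z. - B / z\<^sup>2) has_vector_derivative 2 * B / z ^ 3) (at z within {u..u'})"
        by (simp add: has_real_derivative_iff_has_vector_derivative)
    qed
    note J = this
    have bd': "f z \<le> 2 * B / z ^ 3 \<and> - (2 * B / z ^ 3) \<le> f z" if "z \<in> {u..u'}" for z
      using bd[of z] that u by (simp add: abs_le_iff)
    have "I \<le> - B / u'\<^sup>2 - (- B / u\<^sup>2)"
      by (rule has_integral_le[OF I J]) (use bd' in blast)
    moreover have "- (- B / u'\<^sup>2 - (- B / u\<^sup>2)) \<le> I"
      by (rule has_integral_le[OF has_integral_neg[OF J] I]) (use bd' in blast)
    moreover have "B / u'\<^sup>2 \<ge> 0" using B0 by simp
    ultimately show ?thesis unfolding I' by (simp add: abs_le_iff)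
  qed
  have "Cauchy (\<lambda>k. F (real k))"
  proof (rule CauchyI')
    fix e :: real assume e: "e > 0"
    have "((\<lambda>k. B / (real k)\<^sup>2) \<longlongrightarrow> 0) sequentially" by real_asymp
    then have "eventually (\<lambda>k. B / (real k)\<^sup>2 < e \<and> real k \<ge> a) sequentially"
      using e by (intro eventually_conj order_tendstoD(2)) 
        (auto intro: eventually_mono[OF eventually_ge_at_top[of "nat \<lceil>a\<rceil>"]] simp: nat_le_iff ceiling_le_iff)
    then obtain K where K: "\<And>k. k \<ge> K \<Longrightarrow> B / (real k)\<^sup>2 < e \<and> real k \<ge> a"
      by (auto simp: eventually_sequentially)
    show "\<exists>K. \<forall>m\<ge>K. \<forall>n>m. dist (F (real m)) (F (real n)) < e"
    proof (intro exI allI impI)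
      fix m n assume mn: "m \<ge> K" "n > m"
      have "\<bar>F (real n) - F (real m)\<bar> \<le> B / (real m)\<^sup>2" using K[OF mn(1)] mn by (intro diff) auto
      then show "dist (F (real m)) (F (real n)) < e" using K[OF mn(1)] by (simp add: dist_real_def abs_minus_commute)
    qed
  qed
  then obtain L where L: "(\<lambda>k. F (real k)) \<longlonglongrightarrow> L" by (auto simp: Cauchy_convergent_iff convergent_def)
  have "\<bar>F u - L\<bar> \<le> B / u\<^sup>2" if u: "u \<ge> a" for u
  proof (rule tendsto_upperbound)
    show "(\<lambda>k. \<bar>F u - F (real k)\<bar>) \<longlonglongrightarrow> \<bar>F u - L\<bar>" by (intro tendsto_intros L)
    show "eventually (\<lambda>k. \<bar>F u - F (real k)\<bar> \<le> B / u\<^sup>2) sequentially"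
      using eventually_ge_at_top[of "nat \<lceil>u\<rceil>"]
    proof eventually_elim
      case (elim k)
      then have "u \<le> real k" by (simp add: nat_le_iff ceiling_le_iff)
      then have "\<bar>F (real k) - F u\<bar> \<le> B / u\<^sup>2" by (rule diff[OF u])
      then show ?case by (subst abs_minus_commute)
    qed
  qed simp
  then show ?thesis by blast
qed

text \<open>Inserting \<open>mertens1_integral (exp z) = z\<^sup>2 / 2 - \<gamma> z + O(1)\<close>, the integrand becomes
  \<open>1 / z - 2 \<gamma> / z\<^sup>2 + O(1 / z\<^sup>3)\<close>. The bounded remainder contributes a constant up to \<open>O(1 / u\<^sup>2)\<close>, so that
  the only unknown left at order \<open>1 / u\<close> is \<open>mertens1\<close> itself.\<close>
lemma mertens2_asymptotics:
  "\<exists>C B. \<forall>x\<ge>2. \<bar>mertens2 (nat \<lfloor>x\<rfloor>) - ln (ln x) - C - (mertens1 (nat \<lfloor>x\<rfloor>) - ln x + euler_mascheroni) / ln x\<bar>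
            \<le> B / (ln x)\<^sup>2"
proof -
  define g :: real where "g = euler_mascheroni"
  define a :: real where "a = ln 2"
  have a: "a > 0" by (simp add: a_def)
  obtain B where B: "\<And>x. x \<ge> 1 \<Longrightarrow> \<bar>mertens1_integral x - ((ln x)\<^sup>2 / 2 - g * ln x)\<bar> \<le> B"
    using mertens1_integral_asymptotics unfolding g_def by blast
  define f where "f = (\<lambda>z. 2 * mertens1_integral (exp z) / z ^ 3 - (1 / z - 2 * g / z\<^sup>2))"
  define F where "F = (\<lambda>u. mertens2 (nat \<lfloor>exp u\<rfloor>) - mertens1 (nat \<lfloor>exp u\<rfloor>) / u - mertens1_integral (exp u) / u\<^sup>2
      - ((ln u + 2 * g / u) - (ln a + 2 * g / a)))"
  have "(f has_integral F u) {a..u}" if u: "u \<ge> a" for u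
    unfolding f_def F_def
  proof (rule has_integral_diff)
    have "exp u \<ge> 2" using u unfolding a_def by (metis exp_le_cancel_iff exp_ln zero_less_numeral)
    then show "((\<lambda>z. 2 * mertens1_integral (exp z) / z ^ 3) has_integral
      (mertens2 (nat \<lfloor>exp u\<rfloor>) - mertens1 (nat \<lfloor>exp u\<rfloor>) / u - mertens1_integral (exp u) / u\<^sup>2)) {a..u}"
      using mertens2_has_integral[of "exp u"] by (simp add: a_def)
    show "((\<lambda>z. 1 / z - 2 * g / z\<^sup>2) has_integral (ln u + 2 * g / u) - (ln a + 2 * g / a)) {a..u}"
    proof (rule fundamental_theorem_of_calculus[OF u])
      fix z assume z: "z \<in> {a..u}"
      then have "z > 0" using a by auto
      then have "((\<lambda>z. ln z + 2 * g / z) has_real_derivative 1 / z - 2 * g / z\<^sup>2) (at z within {a..u})"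
        by (auto intro!: derivative_eq_intros simp: field_simps power2_eq_square)
      then show "((\<lambda>z. ln z + 2 * g / z) has_vector_derivative 1 / z - 2 * g / z\<^sup>2) (at z within {a..u})"
        by (simp add: has_real_derivative_iff_has_vector_derivative)
    qed
  qed
  moreover have "\<bar>f z\<bar> \<le> 2 * B / z ^ 3" if z: "z \<ge> a" for z
  proof -
    have z0: "z > 0" using z a by simp
    have "f z = 2 / z ^ 3 * (mertens1_integral (exp z) - (z\<^sup>2 / 2 - g * z))"
      using z0 unfolding f_def by (simp add: field_simps power2_eq_square power3_eq_cube)
    also have "\<bar>\<dots>\<bar> = 2 / z ^ 3 * \<bar>mertens1_integral (exp z) - (z\<^sup>2 / 2 - g * z)\<bar>"
    proof -
      have "\<bar>2 / z ^ 3\<bar> = 2 / z ^ 3" using z0 by simp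
      then show ?thesis by (simp only: abs_mult)
    qed
    also have "\<dots> \<le> 2 / z ^ 3 * B" using B[of "exp z"] z0 by (intro mult_left_mono) auto
    finally show ?thesis by simp
  qed
  ultimately obtain L where L: "\<And>u. u \<ge> a \<Longrightarrow> \<bar>F u - L\<bar> \<le> B / u\<^sup>2"
    using limit_of_has_integral_cubic_bound[OF a, of f F B] by blast
  \<comment> \<open>\<open>3 / 2\<close> is 1 from \<open>mertens1 / u\<close> plus \<open>1 / 2\<close> from \<open>mertens1_integral / u\<^sup>2\<close>; the terms in \<open>a\<close>
     come from the lower end of the integral.\<close>
  define C where "C = 3 / 2 - ln a - 2 * g / a + L"
  have "\<bar>mertens2 (nat \<lfloor>x\<rfloor>) - ln (ln x) - C - (mertens1 (nat \<lfloor>x\<rfloor>) - ln x + g) / ln x\<bar> \<le> 2 * B / (ln x)\<^sup>2"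
    if x: "x \<ge> 2" for x
  proof -
    define u where "u = ln x"
    have u: "u \<ge> a" using x by (simp add: u_def a_def)
    have u0: "u > 0" using u a by simp
    have eu: "exp u = x" using x by (simp add: u_def)
    define r where "r = mertens1_integral x - (u\<^sup>2 / 2 - g * u)"
    have "\<bar>r\<bar> \<le> B" using B[of x] x by (simp add: r_def u_def)
    then have r: "\<bar>r / u\<^sup>2\<bar> \<le> B / u\<^sup>2" by (simp add: abs_divide divide_right_mono)
    have "mertens2 (nat \<lfloor>x\<rfloor>) - ln u - C - (mertens1 (nat \<lfloor>x\<rfloor>) - u + g) / u = (F u - L) + r / u\<^sup>2"
    proof -
      have "mertens1_integral x / u\<^sup>2 = 1 / 2 - g / u + r / u\<^sup>2"
        using u0 unfolding r_def by (simp add: field_simps power2_eq_square)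
      moreover have "(mertens1 (nat \<lfloor>x\<rfloor>) - u + g) / u = mertens1 (nat \<lfloor>x\<rfloor>) / u - 1 + g / u"
        using u0 by (simp add: field_simps)
      ultimately show ?thesis unfolding F_def C_def eu by simp
    qed
    also have "\<bar>\<dots>\<bar> \<le> B / u\<^sup>2 + B / u\<^sup>2" using L[OF u] r by linarith
    finally show ?thesis unfolding u_def by simp
  qed
  then show ?thesis unfolding g_def by blast
qed

section \<open>An upper bound from the Euler product\<close>

lemma sum_powr_upper:
  fixes e :: real
  assumes e: "e > 0" and N: "N \<ge> 1"
  shows "(\<Sum>n=1..N. real n powr (-(1+e))) \<le> 1 + 1 / e - real N powr (-e) / e"
  using N
proof (induction N rule: dec_induct)
  case (step N)
  have N: "real N \<ge> 1" using step by simp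
  have "\<exists>z>real N. z < real N + 1 \<and> (real N + 1) powr (-e) - real N powr (-e) = (real N + 1 - real N) * (- e * z powr (-e - 1))"
    using N by (intro MVT2) (auto intro!: derivative_eq_intros)
  then obtain z where z: "z > real N" "z < real N + 1" 
    "(real N + 1) powr (-e) - real N powr (-e) = - e * z powr (-e - 1)" by auto
  have "-(1+e) = -e - 1" by simp
  moreover have "(real N + 1) powr (-e - 1) \<le> z powr (-e - 1)" using z N e by (intro powr_mono2') auto
  ultimately have "(real N + 1) powr (-(1+e)) \<le> z powr (-e - 1)" by (simp only:)
  then have "e * (real N + 1) powr (-(1+e)) \<le> e * z powr (-e - 1)"
    using e by (intro mult_left_mono) auto
  then have "(real N + 1) powr (-(1+e)) * e \<le> real N powr (-e) - (real N + 1) powr (-e)"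
    using z(3) mult.commute[of e "(real N + 1) powr (-(1+e))"] by linarith
  then have "(real N + 1) powr (-(1+e)) \<le> (real N powr (-e) - (real N + 1) powr (-e)) / e"
    by (subst pos_le_divide_eq[OF e])
  then show ?case using step by (simp add: add_ac diff_divide_distrib)
qed simp

lemma sum_powr_finite_upper:
  fixes e :: real
  assumes e: "e > 0" and F: "finite F" "F \<subseteq> {1..}"
  shows "(\<Sum>n\<in>F. real n powr (-(1+e))) \<le> 1 + 1 / e"
proof -
  define N where "N = Max (insert 1 F)"
  have N: "F \<subseteq> {1..N}" "N \<ge> 1" using F unfolding N_def by auto
  have "(\<Sum>n\<in>F. real n powr (-(1+e))) \<le> (\<Sum>n=1..N. real n powr (-(1+e)))"
    using N by (intro sum_mono2) auto
  also have "\<dots> \<le> 1 + 1 / e - real N powr (-e) / e" by (rule sum_powr_upper[OF e N(2)])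
  finally show ?thesis using e by (smt (verit) divide_nonneg_pos powr_ge_zero)
qed

lemma powr_summable_on:
  fixes e :: real
  assumes e: "e > 0" and A: "A \<subseteq> {1..}"
  shows "(\<lambda>n. real n powr (-(1+e))) summable_on A"
proof (rule nonneg_bdd_above_summable_on)
  show "bdd_above (sum (\<lambda>n. real n powr (-(1+e))) ` {F. F \<subseteq> A \<and> finite F})"
  proof (rule bdd_aboveI2)
    fix F assume "F \<in> {F. F \<subseteq> A \<and> finite F}"
    then have "finite F" "F \<subseteq> {1..}" using A by auto
    then show "(\<Sum>n\<in>F. real n powr (-(1+e))) \<le> 1 + 1 / e" by (rule sum_powr_finite_upper[OF e])
  qed
qed auto

text \<open>The sieve form of the Euler product: removing the multiples of \<open>p\<close> from a set closed under division
  and multiplication by \<open>p\<close> multiplies its Dirichlet series by \<open>1 - p powr (- s)\<close>. Here \<open>s = 1 + e\<close>.\<close>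
lemma sieve_infsum:
  fixes e :: real
  assumes e: "e > 0" and P: "finite P" "\<And>p. p \<in> P \<Longrightarrow> prime p"
  shows "infsum (\<lambda>n. real n powr (-(1+e))) {n::nat. n \<ge> 1 \<and> (\<forall>p\<in>P. \<not> p dvd n)}
       = (\<Prod>p\<in>P. 1 - real p powr (-(1+e))) * infsum (\<lambda>n. real n powr (-(1+e))) {1..}"
  using P
proof (induction P rule: finite_induct)
  case empty
  then show ?case by (simp add: atLeast_def)
next
  case (insert p P)
  define f where "f = (\<lambda>n::nat. real n powr (-(1+e)))"
  define A where "A = {n::nat. n \<ge> 1 \<and> (\<forall>p\<in>P. \<not> p dvd n)}"
  define A' where "A' = {n::nat. n \<ge> 1 \<and> (\<forall>p\<in>insert p P. \<not> p dvd n)}"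
  have p: "prime p" using insert by auto
  then have p0: "p > 0" by (auto intro: prime_gt_0_nat)
  have split: "A = A' \<union> (*) p ` A"
  proof (intro equalityI subsetI)
    fix n assume n: "n \<in> A"
    show "n \<in> A' \<union> (*) p ` A"
    proof (cases "p dvd n")
      case True
      then obtain m where "n = p * m" by blast
      with n have "m \<in> A" "n = p * m" unfolding A_def by auto
      then show ?thesis by auto
    qed (use n in \<open>auto simp: A_def A'_def\<close>)
  next
    fix n assume "n \<in> A' \<union> (*) p ` A"
    then show "n \<in> A"
    proof
      assume "n \<in> (*) p ` A"
      then obtain m where m: "m \<in> A" "n = p * m" by auto
      have "\<not> q dvd n" if "q \<in> P" for q
      proof -
        have "prime q" "q \<noteq> p" using insert that by auto
        then have "\<not> q dvd p" using p primes_dvd_imp_eq by blast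
        moreover have "\<not> q dvd m" using m(1) that unfolding A_def by blast
        ultimately show ?thesis using \<open>prime q\<close> unfolding m(2) by (simp add: prime_dvd_mult_iff)
      qed
      then show ?thesis using m p0 unfolding A_def by auto
    qed (auto simp: A_def A'_def)
  qed
  have sub: "A' \<subseteq> {1..}" "(*) p ` A \<subseteq> {1..}" using p0 unfolding A_def A'_def by (auto simp: Suc_le_eq)
  have "infsum f A = infsum f A' + infsum f ((*) p ` A)"
    unfolding split[symmetric] 
    by (subst (1) split, rule infsum_Un_disjoint) 
       (use sub powr_summable_on[OF e] in \<open>auto simp: f_def A'_def\<close>)
  also have "infsum f ((*) p ` A) = infsum (f \<circ> (*) p) A"
    using p0 by (intro infsum_reindex) (auto simp: inj_on_def)
  also have "\<dots> = infsum (\<lambda>n. real p powr (-(1+e)) * f n) A"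
    by (intro infsum_cong) (auto simp: f_def powr_mult)
  also have "\<dots> = real p powr (-(1+e)) * infsum f A" by (rule infsum_cmult_right')
  finally have "infsum f A' = (1 - real p powr (-(1+e))) * infsum f A"
    unfolding left_diff_distrib by linarith
  also have "infsum f A = (\<Prod>p\<in>P. 1 - real p powr (-(1+e))) * infsum f {1..}"
    using insert unfolding A_def f_def by auto
  finally show ?case using insert unfolding A'_def f_def by simp
qed

text \<open>The sieved set still contains 1, so its Dirichlet series is at least 1, and
  \<open>\<zeta>(1 + e) \<le> 1 + 1 / e\<close>.\<close>
lemma euler_product_upper:
  fixes e :: real
  assumes e: "e > 0" and P: "finite P" "\<And>p::nat. p \<in> P \<Longrightarrow> prime p"
  shows "(\<Sum>p\<in>P. - ln (1 - real p powr (-(1+e)))) \<le> ln (1 + 1 / e)"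
proof -
  define f where "f = (\<lambda>n::nat. real n powr (-(1+e)))"
  define A where "A = {n::nat. n \<ge> 1 \<and> (\<forall>p\<in>P. \<not> p dvd n)}"
  define E where "E = (\<Prod>p\<in>P. 1 - real p powr (-(1+e)))"
  have pos: "1 - real p powr (-(1+e)) > 0" if "p \<in> P" for p
  proof -
    have "real p > 1" using P(2)[OF that] by (auto dest: prime_gt_1_nat)
    then have "real p powr (-(1+e)) < real p powr 0" using e by (intro powr_less_mono) auto
    then show ?thesis using \<open>real p > 1\<close> by simp
  qed
  then have E: "E > 0" unfolding E_def by (intro prod_pos) auto
  have "1 \<in> A" proof -
    have "1 \<notin> P" using P(2)[of 1] by auto
    then show ?thesis unfolding A_def by auto
  qed
  have "sum f {1} \<le> infsum f A"
    by (rule finite_sum_le_infsum) (use \<open>1 \<in> A\<close> powr_summable_on[OF e, of A] in \<open>auto simp: f_def A_def\<close>)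
  also have "\<dots> = E * infsum f {1..}"
    unfolding E_def f_def A_def by (rule sieve_infsum[OF e P])
  also have "\<dots> \<le> E * (1 + 1 / e)"
  proof (rule mult_left_mono)
    show "infsum f {1..} \<le> 1 + 1 / e" unfolding f_def
      by (rule infsum_le_finite_sums[OF powr_summable_on[OF e]]) (simp_all only: sum_powr_finite_upper[OF e] order_refl)
  qed (use E in simp)
  finally have "1 \<le> E * (1 + 1 / e)" by (simp add: f_def)
  then have "ln 1 \<le> ln (E * (1 + 1 / e))" by (subst ln_le_cancel_iff) (use E in \<open>auto intro: less_le_trans\<close>)
  also have "\<dots> = ln E + ln (1 + 1 / e)"
  proof -
    have "1 + 1 / e > 0" using e by (intro add_pos_pos) auto
    then show ?thesis using E by (simp add: ln_mult)
  qed
  also have "ln E = (\<Sum>p\<in>P. ln (1 - real p powr (-(1+e))))"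
    unfolding E_def by (rule ln_prod[OF P(1)]) (use pos in \<open>metis less_irrefl\<close>)
  finally show ?thesis by (simp add: sum_negf)
qed

definition prime_exponents :: "nat \<Rightarrow> nat \<Rightarrow> nat set" where
  "prime_exponents N p = {k\<in>{1..N}. p ^ k \<le> N}"

lemma finite_prime_exponents [simp, intro]: "finite (prime_exponents N p)" by (simp add: prime_exponents_def)

lemma sum_mangoldt_eq:
  fixes g :: "nat \<Rightarrow> real"
  shows "(\<Sum>n=1..N. Lam n * g n) = (\<Sum>p | prime p \<and> p \<le> N. \<Sum>k\<in>prime_exponents N p. ln (real p) * g (p ^ k))"
proof -
  have "(\<Sum>n=1..N. Lam n * g n) = (\<Sum>n\<in>{n\<in>{1..N}. primepow n}. Lam n * g n)"
    by (rule sum.mono_neutral_right) (auto simp: mangoldt_def)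
  also have "\<dots> = (\<Sum>(p,k)\<in>Sigma {p. prime p \<and> p \<le> N} (prime_exponents N). ln (real p) * g (p ^ k))"
  proof (rule sum.reindex_bij_witness[where i="\<lambda>(p,k). p ^ k" 
      and j="\<lambda>n. (aprimedivisor n, multiplicity (aprimedivisor n) n)"], goal_cases)
    case (1 n)
    then show ?case by (auto intro: primepow_decompose)
  next
    case (2 n)
    then have n: "primepow n" "n \<ge> 1" "n \<le> N" by auto
    define p where "p = aprimedivisor n"
    define k where "k = multiplicity p n"
    have pk: "p ^ k = n" using primepow_decompose[OF n(1)] by (simp add: p_def k_def)
    have p: "prime p" unfolding p_def using n by (intro prime_aprimedivisor') auto
    have "k \<noteq> 0" using pk n by (intro notI) auto
    moreover have "k < p ^ k" using p by (intro power_gt_expt) (auto dest: prime_gt_1_nat)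
    moreover have "p \<le> n" using \<open>k \<noteq> 0\<close> pk n(2) 
      by (metis dvd_imp_le dvd_power gr0I less_le_trans not_one_le_zero)
    ultimately show ?case using n p pk unfolding p_def[symmetric] k_def[symmetric] by (auto simp: prime_exponents_def)
  next
    case (3 a)
    then show ?case by (auto simp: prime_exponents_def aprimedivisor_prime_power prime_elem_multiplicity_power_distrib)
  next
    case (4 a)
    then show ?case by (auto simp: prime_exponents_def Suc_le_eq prime_gt_0_nat)
  next
    case (5 n)
    then have n: "primepow n" by auto
    then show ?case using primepow_decompose[OF n] by (simp add: mangoldt_def)
  qed
  also have "\<dots> = (\<Sum>p | prime p \<and> p \<le> N. \<Sum>k\<in>prime_exponents N p. ln (real p) * g (p ^ k))"
    by (rule sum.Sigma[symmetric]) auto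
  finally show ?thesis .
qed

lemma ln_one_minus_sums:
  fixes y :: real
  assumes "0 \<le> y" "y < 1"
  shows "(\<lambda>k. y ^ k / real k) sums (- ln (1 - y))"
  using sums_minus[OF ln_series'[of "-y"]] assms by simp

lemma sum_power_over_le_ln:
  fixes y :: real
  assumes "0 \<le> y" "y < 1" "finite A"
  shows "(\<Sum>k\<in>A. y ^ k / real k) \<le> - ln (1 - y)"
  using sum_le_suminf[OF sums_summable[OF ln_one_minus_sums[OF assms(1,2)]] assms(3)]
    sums_unique[OF ln_one_minus_sums[OF assms(1,2)]] assms by auto

text \<open>For \<open>n = p ^ k\<close> the summand is \<open>y ^ k / k\<close> with \<open>y = p powr (- (1 + e))\<close>, a term of the series
  of \<open>- log (1 - y)\<close>. So the left-hand side is a partial sum of \<open>log \<zeta>(1 + e)\<close>.\<close>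
lemma damped_mertens2_upper:
  assumes e: "e > 0"
  shows "(\<Sum>n=1..N. Lam n / (real n * ln (real n)) * real n powr (-e)) \<le> ln (1 + 1 / e)"
proof -
  have "(\<Sum>n=1..N. Lam n / (real n * ln (real n)) * real n powr (-e))
     = (\<Sum>n=1..N. Lam n * (1 / (real n * ln (real n)) * real n powr (-e)))"
    by simp
  also have "\<dots> = (\<Sum>p | prime p \<and> p \<le> N. \<Sum>k\<in>prime_exponents N p. ln (real p) * (1 / (real (p^k) * ln (real (p^k))) * real (p^k) powr (-e)))"
    by (rule sum_mangoldt_eq)
  also have "\<dots> = (\<Sum>p | prime p \<and> p \<le> N. \<Sum>k\<in>prime_exponents N p. (real p powr (-(1+e))) ^ k / real k)"
  proof (intro sum.cong refl)
    fix p k assume "p \<in> {p. prime p \<and> p \<le> N}" "k \<in> prime_exponents N p"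
    then have p: "real p > 1" and k: "k \<ge> 1" by (auto simp: prime_exponents_def dest: prime_gt_1_nat)
    have "(real p powr (-(1+e))) ^ k = real p powr (-(1+e) * real k)"
      using p by (subst powr_power) (auto simp: mult.commute)
    also have "-(1+e) * real k = - real k + real k * (-e)" by (simp add: algebra_simps)
    also have "real p powr \<dots> = real p powr (- real k) * real p powr (real k * (-e))"
      by (rule powr_add)
    also have "real p powr (- real k) = 1 / real p ^ k" 
      using p by (simp only: powr_minus_divide) (simp add: powr_realpow)
    also have "real p powr (real k * (-e)) = (real p ^ k) powr (-e)"
      using p by (subst powr_realpow[symmetric], simp, subst powr_powr) simp
    finally have "(real p powr (-(1+e))) ^ k = 1 / real p ^ k * (real p ^ k) powr (-e)" .
    moreover have "ln (real p) > 0" using p by simp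
    ultimately show "ln (real p) * (1 / (real (p^k) * ln (real (p^k))) * real (p^k) powr (-e)) = (real p powr (-(1+e))) ^ k / real k"
      using k p by (simp add: ln_realpow)
  qed
  also have "\<dots> \<le> (\<Sum>p | prime p \<and> p \<le> N. - ln (1 - real p powr (-(1+e))))"
  proof (intro sum_mono sum_power_over_le_ln)
    fix p assume "p \<in> {p. prime p \<and> p \<le> N}"
    then have p: "real p > 1" by (auto dest: prime_gt_1_nat)
    have "real p powr (-(1+e)) < real p powr 0" using e p by (intro powr_less_mono) auto
    then show "real p powr (-(1+e)) < 1" using p by simp
  qed auto
  also have "\<dots> \<le> ln (1 + 1 / e)" by (rule euler_product_upper[OF e]) auto
  finally show ?thesis .
qed

section \<open>The constant in Mertens' second theorem\<close>

text \<open>A one-sided, quantitative form of Abel's limit theorem: summation by parts turns the power series into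
  an average of the partial sums \<open>s k\<close> with weights \<open>z ^ k - z ^ Suc k\<close>.\<close>
lemma abel_sum_lower:
  fixes s :: "nat \<Rightarrow> real"
  assumes s0: "s 0 = 0" and m: "\<And>k. s k \<ge> - m" and d: "\<And>k. k \<ge> K0 \<Longrightarrow> s k \<ge> d"
    and z: "0 < z" "z < 1" and K: "K \<ge> K0"
  shows "(\<Sum>k<K. (s (Suc k) - s k) * z ^ Suc k) \<ge> d * z ^ K0 - m * (1 - z ^ K0)"
proof -
  \<comment> \<open>Summation by parts: \<open>R k\<close> is the sum of \<open>s j * (z ^ j - z ^ Suc j)\<close> over \<open>j < k\<close>.\<close>
  define R where "R = (\<lambda>K. (\<Sum>k<K. (s (Suc k) - s k) * z ^ Suc k) - s K * z ^ K)"
  have R_Suc: "R (Suc k) = R k + s k * (z ^ k - z ^ Suc k)" for k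
    unfolding R_def by (simp add: algebra_simps)
  have dec: "z ^ k - z ^ Suc k \<ge> 0" for k using z by (simp add: mult_left_le_one_le)
  have 1: "R k \<ge> - m * (1 - z ^ k)" for k
  proof (induction k)
    case (Suc k)
    have "s k * (z ^ k - z ^ Suc k) \<ge> (- m) * (z ^ k - z ^ Suc k)"
      by (rule mult_right_mono[OF m dec])
    then show ?case unfolding R_Suc using Suc by (simp add: algebra_simps)
  qed (simp add: R_def s0)
  have "R K \<ge> - m * (1 - z ^ K0) + d * (z ^ K0 - z ^ K)" using K
  proof (induction K rule: dec_induct)
    case (step k)
    have "s k * (z ^ k - z ^ Suc k) \<ge> d * (z ^ k - z ^ Suc k)"
      using step by (intro mult_right_mono[OF d dec]) auto
    then show ?case unfolding R_Suc using step by (simp add: algebra_simps)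
  qed (use 1 in simp)
  moreover have "s K * z ^ K \<ge> d * z ^ K" using d[OF K] z by (intro mult_right_mono) auto
  ultimately show ?thesis unfolding R_def by (simp add: algebra_simps)
qed

text \<open>Cutting at the points \<open>exp k\<close> compares the Dirichlet series \<open>log \<zeta>(1 + e)\<close> with a power series
  in \<open>exp (- e)\<close>: on the block \<open>exp k < n \<le> exp (Suc k)\<close> the factor \<open>n powr (- e)\<close> is
  at least \<open>exp (- e) ^ Suc k\<close>.\<close>
lemma mertens2_power_series_upper:
  assumes e: "e > 0"
  shows "(\<Sum>k<K. (mertens2 (nat \<lfloor>exp (real (Suc k))\<rfloor>) - mertens2 (nat \<lfloor>exp (real k)\<rfloor>)) * exp (- e) ^ Suc k) \<le> ln (1 + 1 / e)"
proof -
  define E where "E = (\<lambda>k::nat. nat \<lfloor>exp (real k)\<rfloor>)"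
  define g where "g = (\<lambda>n. Lam n / (real n * ln (real n)))"
  define D where "D = (\<lambda>N::nat. \<Sum>n=1..N. g n * real n powr (-e))"
  have g: "g n \<ge> 0" for n 
    unfolding g_def by (cases "n = 0") (auto intro!: divide_nonneg_nonneg mult_nonneg_nonneg simp: mangoldt_nonneg)
  have mono: "E k \<le> E (Suc k)" for k unfolding E_def by (intro nat_mono floor_mono) auto
  have split: "(\<Sum>n=1..E (Suc k). h n) = (\<Sum>n=1..E k. h n) + (\<Sum>n\<in>{E k<..E (Suc k)}. h n)" for h :: "nat \<Rightarrow> real" and k
  proof -
    have "{1..E (Suc k)} = {1..E k} \<union> {E k<..E (Suc k)}" using mono[of k] by auto
    then show ?thesis by (subst sum.union_disjoint[symmetric]) auto
  qed
  have step: "(mertens2 (E (Suc k)) - mertens2 (E k)) * exp (- e) ^ Suc k \<le> D (E (Suc k)) - D (E k)" for k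
  proof -
    have "(mertens2 (E (Suc k)) - mertens2 (E k)) * exp (- e) ^ Suc k = (\<Sum>n\<in>{E k<..E (Suc k)}. g n * exp (- e) ^ Suc k)"
      unfolding mertens2_def g_def[symmetric] split by (simp only: add_diff_cancel_left' sum_distrib_right)
    also have "\<dots> \<le> (\<Sum>n\<in>{E k<..E (Suc k)}. g n * real n powr (-e))"
    proof (intro sum_mono mult_left_mono g)
      fix n assume n: "n \<in> {E k<..E (Suc k)}"
      then have n0: "real n > 0" by auto
      have "real (E (Suc k)) \<le> exp (real (Suc k))" unfolding E_def by (simp add: of_nat_floor)
      then have "real n \<le> exp (real (Suc k))" using n by auto
      then have "ln (real n) \<le> real (Suc k)" using n0 by (metis exp_gt_zero ln_exp ln_le_cancel_iff)
      then have "- e * real (Suc k) \<le> - e * ln (real n)" using e by (intro mult_left_mono_neg) auto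
      then have "exp (- e * real (Suc k)) \<le> exp (- e * ln (real n))" by simp
      also have "exp (- e * ln (real n)) = real n powr (-e)" using n0 by (simp add: powr_def)
      also have "exp (- e * real (Suc k)) = exp (- e) ^ Suc k" by (simp only: exp_of_nat2_mult)
      finally show "exp (- e) ^ Suc k \<le> real n powr (-e)" .
    qed
    also have "\<dots> = D (E (Suc k)) - D (E k)" unfolding D_def split by simp
    finally show ?thesis .
  qed
  have "(\<Sum>k<K. (mertens2 (E (Suc k)) - mertens2 (E k)) * exp (- e) ^ Suc k) \<le> (\<Sum>k<K. D (E (Suc k)) - D (E k))"
    by (intro sum_mono step)
  also have "\<dots> = D (E K) - D (E 0)" by (rule sum_lessThan_telescope)
  also have "\<dots> = D (E K)" by (simp add: D_def E_def g_def)
  also have "\<dots> \<le> ln (1 + 1 / e)" unfolding D_def g_def by (rule damped_mertens2_upper[OF e])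
  finally show ?thesis unfolding E_def .
qed

text \<open>Both \<open>log \<zeta>(1 + e)\<close> and \<open>\<Sum> exp (- e k) / k = - log (1 - exp (- e))\<close> are \<open>log (1 / e) + o(1)\<close>.
  Their partial sums up to \<open>k\<close>, in the sense of the preceding lemma for the first, are \<open>log k + C\<close>
  and \<open>harm k = log k + \<gamma>\<close> up to \<open>o(1)\<close>. If \<open>C > \<gamma>\<close>, then by the Abelian lemma the first series would
  exceed the second by a fixed amount as \<open>e\<close> tends to 0.\<close>
lemma mertens_constant_le:
  assumes lim: "(\<lambda>k. mertens2 (nat \<lfloor>exp (real k)\<rfloor>) - ln (real k)) \<longlonglongrightarrow> C"
  shows "C \<le> euler_mascheroni"
proof (rule ccontr)
  define E where "E = (\<lambda>k::nat. nat \<lfloor>exp (real k)\<rfloor>)"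
  define s where "s = (\<lambda>k. mertens2 (E k) - harm k)"
  \<comment> \<open>Half of the supposed excess, so that the partial sums are eventually at least \<open>d\<close>.\<close>
  define d :: real where "d = (C - euler_mascheroni) / 2"
  assume "\<not> C \<le> euler_mascheroni"
  then have d: "d > 0" by (simp add: d_def)
  have s: "s \<longlonglongrightarrow> C - euler_mascheroni"
    using tendsto_diff[OF lim euler_mascheroni_LIMSEQ] by (simp add: s_def E_def)
  have "C - euler_mascheroni > d" using d by (simp add: d_def)
  then obtain K0 where K0: "\<And>k. k \<ge> K0 \<Longrightarrow> s k \<ge> d"
    using order_tendstoD(1)[OF s] by (meson eventually_sequentially less_imp_le)
  obtain m where m: "\<And>k. norm (s k) \<le> m"
    using convergent_imp_Bseq[of s] s by (auto simp: convergent_def Bseq_def)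
  have m': "s k \<ge> - m" for k using m[of k] by auto
  have s0: "s 0 = 0" by (simp add: s_def E_def mertens2_def harm_def)
  have key: "d * exp (- e) ^ K0 - m * (1 - exp (- e) ^ K0) \<le> ln (1 + e)" if e: "e > 0" for e :: real
  proof -
    define z where "z = exp (- e)"
    have z: "0 < z" "z < 1" using e by (auto simp: z_def)
    have ub: "d * z ^ K0 - m * (1 - z ^ K0) + (\<Sum>k<Suc K. z ^ k / real k) \<le> ln (1 + 1 / e)" if K: "K \<ge> K0" for K
    proof -
      have "(\<Sum>k<K. (s (Suc k) - s k) * z ^ Suc k) + (\<Sum>k<K. z ^ Suc k / real (Suc k))
          = (\<Sum>k<K. (mertens2 (E (Suc k)) - mertens2 (E k)) * z ^ Suc k)"
        by (simp add: s_def harm_Suc algebra_simps inverse_eq_divide sum.distrib[symmetric] del: of_nat_Suc)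
      also have "\<dots> \<le> ln (1 + 1 / e)" using mertens2_power_series_upper[OF e] unfolding E_def z_def .
      finally have "(\<Sum>k<K. (s (Suc k) - s k) * z ^ Suc k) + (\<Sum>k<K. z ^ Suc k / real (Suc k)) \<le> ln (1 + 1 / e)" .
      moreover have "(\<Sum>k<Suc K. z ^ k / real k) = (\<Sum>k<K. z ^ Suc k / real (Suc k))"
        by (subst sum.lessThan_Suc_shift) simp
      ultimately show ?thesis using abel_sum_lower[of s m K0 d z K, OF s0 m' K0 z K] by linarith
    qed
    have "(\<lambda>K. \<Sum>k<Suc K. z ^ k / real k) \<longlonglongrightarrow> - ln (1 - z)"
      using ln_one_minus_sums[of z] z by (intro LIMSEQ_Suc) (auto simp: sums_def)
    then have "(\<lambda>K. d * z ^ K0 - m * (1 - z ^ K0) + (\<Sum>k<Suc K. z ^ k / real k)) \<longlonglongrightarrow> d * z ^ K0 - m * (1 - z ^ K0) + (- ln (1 - z))"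
      by (intro tendsto_intros)
    then have "d * z ^ K0 - m * (1 - z ^ K0) + (- ln (1 - z)) \<le> ln (1 + 1 / e)"
      using ub by (intro LIMSEQ_le_const2) auto
    moreover have "ln (1 - z) \<le> ln e"
    proof -
      have "1 - z \<le> e" using exp_ge_add_one_self[of "- e"] by (simp add: z_def)
      then show ?thesis using z e by (subst ln_le_cancel_iff) auto
    qed
    moreover have "ln (1 + 1 / e) + ln e = ln (1 + e)"
    proof -
      have "1 + 1 / e > 0" using e by (intro add_pos_pos) auto
      then have "ln (1 + 1 / e) + ln e = ln ((1 + 1 / e) * e)" using e by (simp add: ln_mult)
      also have "(1 + 1 / e) * e = 1 + e" using e by (simp add: distrib_right add.commute)
      finally show ?thesis .
    qed
    ultimately show ?thesis unfolding z_def[symmetric] by linarith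
  qed
  have t1: "((\<lambda>e. d * exp (- e) ^ K0 - m * (1 - exp (- e) ^ K0)) \<longlongrightarrow> d * exp (- 0) ^ K0 - m * (1 - exp (- 0) ^ K0)) (at_right (0::real))"
    by (intro tendsto_intros)
  have t2: "((\<lambda>e. ln (1 + e)) \<longlongrightarrow> ln (1 + 0)) (at_right (0::real))"
    by (intro tendsto_intros) auto
  have "d * exp (- 0) ^ K0 - m * (1 - exp (- 0) ^ K0) \<le> ln (1 + 0)"
    by (rule tendsto_le[OF trivial_limit_at_right_real t2 t1])
       (use key in \<open>auto simp: eventually_at_filter\<close>)
  then show False using d by simp
qed

section \<open>The second Mertens sum up to smaller order than 1/log\<close>

lemma mertens2_upper:
  "\<exists>B. \<forall>N\<ge>2. mertens2 N \<le> ln (ln N) + euler_mascheroni + (mertens1 N - ln N + euler_mascheroni) / ln N + B / (ln (real N))\<^sup>2"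
proof -
  define g :: real where "g = euler_mascheroni"
  obtain C B where CB: "\<And>x. x \<ge> 2 \<Longrightarrow> \<bar>mertens2 (nat \<lfloor>x\<rfloor>) - ln (ln x) - C - (mertens1 (nat \<lfloor>x\<rfloor>) - ln x + g) / ln x\<bar>
            \<le> B / (ln x)\<^sup>2" using mertens2_asymptotics unfolding g_def by blast
  have "(\<lambda>k. mertens2 (nat \<lfloor>exp (real k)\<rfloor>) - ln (real k) - C) \<longlonglongrightarrow> 0"
  proof (rule Lim_null_comparison)
    show "(\<lambda>k. (5 + \<bar>g\<bar>) / real k + B / (real k)\<^sup>2) \<longlonglongrightarrow> 0" by real_asymp
    show "eventually (\<lambda>k. norm (mertens2 (nat \<lfloor>exp (real k)\<rfloor>) - ln (real k) - C) \<le> (5 + \<bar>g\<bar>) / real k + B / (real k)\<^sup>2) sequentially"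
      using eventually_ge_at_top[of 1]
    proof eventually_elim
      case (elim k)
      define N where "N = nat \<lfloor>exp (real k)\<rfloor>"
      have "real k \<ge> 1" using elim by simp
      then have x2: "exp (real k) \<ge> 2" using exp_ge_add_one_self[of "real k"] by linarith
      then have x1: "exp (real k) \<ge> 1" by simp
      note N = nat_floor_facts[OF x1, folded N_def]
      have "1 / real N \<le> 1" using N(1) by simp
      then have "\<bar>mertens1 N - real k\<bar> \<le> 5" using mertens1_minus_ln_bounded[OF N(1)] N(4,5) by simp
      then have "\<bar>mertens1 N - real k + g\<bar> \<le> 5 + \<bar>g\<bar>" by linarith
      then have "\<bar>(mertens1 N - real k + g) / real k\<bar> \<le> (5 + \<bar>g\<bar>) / real k"
        by (simp add: abs_divide divide_right_mono)
      moreover have "\<bar>mertens2 N - ln (real k) - C - (mertens1 N - real k + g) / real k\<bar> \<le> B / (real k)\<^sup>2"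
        using CB[OF x2] unfolding N_def[symmetric] by simp
      ultimately show ?case unfolding N_def[symmetric] real_norm_def by linarith
    qed
  qed
  then have "(\<lambda>k. mertens2 (nat \<lfloor>exp (real k)\<rfloor>) - ln (real k)) \<longlonglongrightarrow> C"
    by (simp add: LIM_zero_iff)
  then have C: "C \<le> g" unfolding g_def by (rule mertens_constant_le)
  have "mertens2 N \<le> ln (ln N) + g + (mertens1 N - ln N + g) / ln N + B / (ln (real N))\<^sup>2" if "N \<ge> 2" for N :: nat
    using CB[of "real N"] that C by simp
  then show ?thesis unfolding g_def by blast
qed

text \<open>Here the unknown \<open>psi N / N\<close> drops out and leaves the explicit coefficient \<open>\<gamma> - 1\<close>.\<close>
lemma mertens2_minus_psi_upper:
  "\<exists>B. \<forall>N\<ge>2. mertens2 N - psi N / (real N * ln N)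
     \<le> ln (ln N) + euler_mascheroni + (euler_mascheroni - 1) / ln N 
       + (1 + ln N) / (real N * ln N) + B / (ln (real N))\<^sup>2"
proof -
  define g :: real where "g = euler_mascheroni"
  obtain B where B: "\<And>N. N \<ge> 2 \<Longrightarrow> mertens2 N \<le> ln (ln N) + g + (mertens1 N - ln N + g) / ln N + B / (ln (real N))\<^sup>2"
    using mertens2_upper unfolding g_def by blast
  have "mertens2 N - psi N / (real N * ln N) \<le> ln (ln N) + g + (g - 1) / ln N + (1 + ln N) / (real N * ln N) + B / (ln (real N))\<^sup>2"
    if N: "N \<ge> 2" for N :: nat
  proof -
    have ln: "ln (real N) > 0" using N by simp
    have "(mertens1 N - ln N + g) / ln N \<le> (psi N / N + (g - 1) + (1 + ln N) / N) / ln N"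
      using mertens1_upper[of N] N ln by (intro divide_right_mono) auto
    also have "\<dots> = psi N / (real N * ln N) + (g - 1) / ln N + (1 + ln N) / (real N * ln N)"
      by (simp add: add_divide_distrib)
    finally show ?thesis using B[OF N] by linarith
  qed
  then show ?thesis unfolding g_def by blast
qed


section \<open>From prime powers to the Mertens product\<close>

lemma ln_one_minus_tail:
  fixes y :: real
  assumes y: "0 \<le> y" "y < 1"
  shows "- ln (1 - y) - (\<Sum>k=1..n. y ^ k / real k) \<le> y ^ Suc n / (1 - y)"
proof -
  define f where "f = (\<lambda>k. y ^ k / real k)"
  have f: "f sums (- ln (1 - y))" unfolding f_def by (rule ln_one_minus_sums[OF y])
  have "(\<lambda>i. f (i + Suc n)) sums (- ln (1 - y) - (\<Sum>i<Suc n. f i))"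
    using f by (subst sums_iff_shift) simp
  moreover have "(\<lambda>i. y ^ Suc n * y ^ i) sums (y ^ Suc n * (1 / (1 - y)))"
    using y by (intro sums_mult geometric_sums) simp
  moreover have "f (i + Suc n) \<le> y ^ Suc n * y ^ i" for i
  proof -
    have "f (i + Suc n) \<le> y ^ (i + Suc n) / 1"
      unfolding f_def using y by (intro divide_left_mono) auto
    then show ?thesis by (simp add: power_add mult_ac)
  qed
  ultimately have "- ln (1 - y) - (\<Sum>i<Suc n. f i) \<le> y ^ Suc n * (1 / (1 - y))"
    by (rule sums_le[rotated])
  moreover have "(\<Sum>i<Suc n. f i) = (\<Sum>k=1..n. f k)"
    by (rule sum.mono_neutral_right) (auto simp: f_def)
  ultimately show ?thesis unfolding f_def by simp
qed

lemma inverse_squares_tail: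
  assumes "r \<ge> 1" "r \<le> N"
  shows "(\<Sum>m\<in>{r<..N}. 1 / (real m)\<^sup>2) \<le> 1 / real r - 1 / real N"
  using assms(2)
proof (induction N rule: dec_induct)
  case (step n)
  have "{r<..Suc n} = insert (Suc n) {r<..n}" using step by auto
  moreover have "1 / (real (Suc n))\<^sup>2 \<le> 1 / real n - 1 / real (Suc n)"
  proof -
    have n: "real n > 0" using step assms by simp
    have "1 / (real (Suc n))\<^sup>2 \<le> 1 / (real n * real (Suc n))"
      using n unfolding power2_eq_square by (intro divide_left_mono mult_right_mono) auto
    also have "\<dots> = 1 / real n - 1 / real (Suc n)" using n by (simp add: field_simps)
    finally show ?thesis .
  qed
  ultimately show ?case using step by simp
qed simp

text \<open>The exponents form an initial segment, which makes the omitted powers a tail of the logarithmic series.\<close>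
lemma prime_exponents_eq:
  assumes p: "p \<ge> 2" and N: "N \<ge> 1"
  obtains n where "prime_exponents N p = {1..n}" "p ^ n \<le> N" "N < p ^ Suc n"
proof -
  define n where "n = (LEAST n. N < p ^ Suc n)"
  have "Suc N < p ^ Suc N" using p by (intro power_gt_expt) auto
  then have "N < p ^ Suc N" by (rule Suc_lessD)
  then have 1: "N < p ^ Suc n" unfolding n_def by (rule LeastI)
  have 2: "p ^ n \<le> N"
  proof (cases n)
    case (Suc k)
    then have "\<not> N < p ^ Suc k" unfolding n_def using not_less_Least by (metis lessI)
    then show ?thesis using Suc by simp
  qed (use N in simp)
  have c1: "k \<le> n" if "p ^ k \<le> N" for k
  proof (rule ccontr)
    assume "\<not> k \<le> n"
    then have "p ^ Suc n \<le> p ^ k" using p by (intro power_increasing) auto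
    then show False using 1 that by simp
  qed
  have c2: "p ^ k \<le> N" if "k \<le> n" for k
    using order_trans[OF power_increasing[OF that] 2] p by simp
  have c3: "k \<le> N" if "p ^ k \<le> N" for k
    using power_gt_expt[of p k] p that by simp
  have "k \<in> prime_exponents N p \<longleftrightarrow> k \<in> {1..n}" for k
    using c1[of k] c2[of k] c3[of k] by (auto simp only: prime_exponents_def mem_Collect_eq atLeastAtMost_iff)
  then have "prime_exponents N p = {1..n}" by blast
  then show thesis using 1 2 that by blast
qed

text \<open>What one prime contributes to the difference between the sum over primes and the sum over prime powers
  up to \<open>N\<close>: the powers of \<open>p\<close> exceeding \<open>N\<close>, and the exponents from 2 on counted in \<open>psi N\<close>. The
  second part is absent unless \<open>p\<^sup>2 \<le> N\<close>.\<close>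
lemma euler_factor_vs_prime_powers:
  assumes p: "prime p" "p \<le> N" and N: "N \<ge> 2" 
  shows "- ln (1 - 1 / real p) - ln p / (real N * ln N) - (\<Sum>k\<in>prime_exponents N p. 1 / (real k * real p ^ k) - ln p / (real N * ln N))
     \<le> (if p ^ 2 \<le> N then 3 / real N else 2 / (real p)\<^sup>2)"
proof -
  have p2: "p \<ge> 2" using p by (auto intro: prime_ge_2_nat)
  obtain n where n: "prime_exponents N p = {1..n}" "p ^ n \<le> N" "N < p ^ Suc n"
    using prime_exponents_eq[OF p2, of N] N by auto
  have lnN: "ln (real N) > 0" using N by simp
  have lnp: "ln (real p) > 0" using p2 by simp
  have n1: "n \<ge> 1" using n(3) p(2) by (cases n) auto
  define l where "l = 1 / (real N * ln N)"
  have l: "l > 0" using N lnN unfolding l_def by simp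
  have "(\<Sum>k\<in>prime_exponents N p. 1 / (real k * real p ^ k) - ln p / (real N * ln N)) = (\<Sum>k=1..n. (1 / real p) ^ k / real k) - real n * (l * ln p)"
    by (simp add: n(1) sum_subtractf l_def power_one_over mult.commute)
  then have "- ln (1 - 1 / real p) - ln p / (real N * ln N) - (\<Sum>k\<in>prime_exponents N p. 1 / (real k * real p ^ k) - ln p / (real N * ln N))
     = (- ln (1 - 1 / real p) - (\<Sum>k=1..n. (1 / real p) ^ k / real k)) + l * ((real n - 1) * ln p)"
    by (simp add: l_def algebra_simps)
  also have "\<dots> \<le> 2 / real p ^ Suc n + l * ((real n - 1) * ln p)"
  proof -
    have "- ln (1 - 1 / real p) - (\<Sum>k=1..n. (1 / real p) ^ k / real k) \<le> (1 / real p) ^ Suc n / (1 - 1 / real p)"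
      using p2 by (intro ln_one_minus_tail) auto
    also have "\<dots> \<le> (1 / real p) ^ Suc n / (1 / 2)"
      using p2 by (intro divide_left_mono) (auto simp: field_simps)
    also have "\<dots> = 2 / real p ^ Suc n" by (simp add: power_one_over)
    finally show ?thesis by simp
  qed
  also have "\<dots> \<le> (if p ^ 2 \<le> N then 3 / real N else 2 / (real p)\<^sup>2)"
  proof (cases "p ^ 2 \<le> N")
    case True
    have "real N \<le> real p ^ Suc n" using n(3) by (metis less_imp_le of_nat_le_iff of_nat_power)
    then have "2 / real p ^ Suc n \<le> 2 / real N" using N by (intro divide_left_mono) auto
    moreover have "l * ((real n - 1) * ln p) \<le> 1 / real N"
    proof -
      have "(real n - 1) * ln p \<le> real n * ln p" using lnp by (intro mult_right_mono) auto
      also have "\<dots> = ln (real (p ^ n))" using p2 by (simp add: ln_realpow)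
      also have "\<dots> \<le> ln (real N)" using n(2) p2 N by (subst ln_le_cancel_iff) (auto simp del: of_nat_power)
      finally have "l * ((real n - 1) * ln p) \<le> l * ln (real N)" using l by (intro mult_left_mono) auto
      also have "\<dots> = 1 / real N" using lnN by (simp add: l_def)
      finally show ?thesis .
    qed
    ultimately show ?thesis using True by simp
  next
    case False
    have "n = 1"
    proof (rule ccontr)
      assume "n \<noteq> 1"
      then have "p ^ 2 \<le> p ^ n" using n1 p2 by (intro power_increasing) auto
      then show False using n(2) False by simp
    qed
    then show ?thesis using False by (simp add: power2_eq_square)
  qed
  finally show ?thesis .
qed

text \<open>The bounds of the previous lemma are summed separately over \<open>p \<le> \<surd>N\<close> and over \<open>p > \<surd>N\<close>.\<close>
lemma mertens_product_vs_mertens2: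
  assumes N: "N \<ge> 2"
  shows "(\<Sum>p | prime p \<and> p \<le> N. - ln (1 - 1 / real p) - ln p / (real N * ln N))
     \<le> mertens2 N - psi N / (real N * ln N) + 10 / sqrt N"
proof -
  define P where "P = {p. prime p \<and> p \<le> N}"
  define b where "b = (\<lambda>m::nat. if m ^ 2 \<le> N then 3 / real N else 2 / (real m)\<^sup>2)"
  define r where "r = nat \<lfloor>sqrt N\<rfloor>"
  have sq1: "sqrt N \<ge> 1" using N by simp
  note r = nat_floor_facts[OF sq1, folded r_def]
  have sq_iff: "m ^ 2 \<le> N \<longleftrightarrow> m \<le> r" for m
  proof -
    have "m ^ 2 \<le> N \<longleftrightarrow> real m \<le> sqrt N" 
      by (metis of_nat_0_le_iff of_nat_le_iff of_nat_power real_le_rsqrt real_sqrt_le_iff real_sqrt_unique sqrt_le_D)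
    also have "\<dots> \<longleftrightarrow> m \<le> r"
    proof
      assume "real m \<le> sqrt N"
      then show "m \<le> r" unfolding r_def by (rule le_nat_floor)
    next
      assume "m \<le> r"
      then show "real m \<le> sqrt N" using r(2) by linarith
    qed
    finally show ?thesis .
  qed
  have "r ^ 2 \<le> N" using sq_iff[of r] by simp
  then have rN: "r \<le> N" "real r ^ 2 \<le> real N" using r(1)
    by (metis le_trans power2_nat_le_imp_le) (metis \<open>r ^ 2 \<le> N\<close> of_nat_le_iff of_nat_power)
  have psiS: "mertens2 N - psi N / (real N * ln N) = (\<Sum>p\<in>P. \<Sum>k\<in>prime_exponents N p. 1 / (real k * real p ^ k) - ln p / (real N * ln N))"
  proof -
    have "mertens2 N - psi N / (real N * ln N) = (\<Sum>n=1..N. Lam n * (1 / (real n * ln n) - 1 / (real N * ln N)))"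
      unfolding mertens2_def psi_def by (simp add: right_diff_distrib sum_subtractf sum_divide_distrib)
    also have "\<dots> = (\<Sum>p\<in>P. \<Sum>k\<in>prime_exponents N p. ln p * (1 / (real (p ^ k) * ln (real (p ^ k))) - 1 / (real N * ln N)))"
      unfolding P_def by (rule sum_mangoldt_eq)
    also have "\<dots> = (\<Sum>p\<in>P. \<Sum>k\<in>prime_exponents N p. 1 / (real k * real p ^ k) - ln p / (real N * ln N))"
    proof (intro sum.cong refl)
      fix p k assume "p \<in> P" "k \<in> prime_exponents N p"
      then have "real p > 1" "k \<ge> 1" by (auto simp: P_def prime_exponents_def dest: prime_gt_1_nat)
      moreover from this have "ln (real p) > 0" by simp
      ultimately show "ln p * (1 / (real (p ^ k) * ln (real (p ^ k))) - 1 / (real N * ln N)) = 1 / (real k * real p ^ k) - ln p / (real N * ln N)"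
        by (simp add: ln_realpow right_diff_distrib)
    qed
    finally show ?thesis .
  qed
  have "(\<Sum>p\<in>P. - ln (1 - 1 / real p) - ln p / (real N * ln N)) - (mertens2 N - psi N / (real N * ln N))
     = (\<Sum>p\<in>P. - ln (1 - 1 / real p) - ln p / (real N * ln N) - (\<Sum>k\<in>prime_exponents N p. 1 / (real k * real p ^ k) - ln p / (real N * ln N)))"
    unfolding psiS by (simp only: sum_subtractf)
  also have "\<dots> \<le> (\<Sum>p\<in>P. b p)"
    unfolding b_def by (intro sum_mono euler_factor_vs_prime_powers N) (auto simp: P_def)
  also have "\<dots> \<le> (\<Sum>m=1..N. b m)"
    by (rule sum_mono2) (auto simp: P_def b_def Suc_le_eq prime_gt_0_nat)
  also have "\<dots> = (\<Sum>m=1..r. b m) + (\<Sum>m\<in>{r<..N}. b m)"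
  proof -
    have "{1..N} = {1..r} \<union> {r<..N}" using rN by auto
    then show ?thesis by (simp add: sum.union_disjoint[symmetric] ivl_disj_int)
  qed
  also have "(\<Sum>m=1..r. b m) = 3 * (real r / real N)"
    unfolding b_def sq_iff by simp
  also have "\<dots> \<le> 3 * (1 / real r)"
    using rN(2) r(1) N by (intro mult_left_mono) (auto simp: field_simps power2_eq_square)
  also have "(\<Sum>m\<in>{r<..N}. b m) = 2 * (\<Sum>m\<in>{r<..N}. 1 / (real m)\<^sup>2)"
    unfolding b_def sq_iff by (simp add: sum_distrib_left)
  also have "\<dots> \<le> 2 * (1 / real r)"
    using inverse_squares_tail[OF r(1) rN(1)] by (intro mult_left_mono) (auto intro: order_trans)
  also have "3 * (1 / real r) + 2 * (1 / real r) = 10 / (2 * real r)" by simp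
  also have "\<dots> \<le> 10 / sqrt N"
  proof (rule divide_left_mono)
    have "real r \<ge> 1" using r(1) by simp
    then show "sqrt N \<le> 2 * real r" using r(3) by linarith
    show "0 < 2 * real r * sqrt N" using \<open>real r \<ge> 1\<close> sq1 by (intro mult_pos_pos) auto
  qed simp
  finally show ?thesis unfolding P_def by linarith
qed


section \<open>Divisor sums of integers with squared prime factors\<close>

text \<open>Linear programming duality with the multiplier \<open>1 / (N log N)\<close>. It is chosen so that
  \<open>- log (1 - 1 / p) - log p / (N log N)\<close> is nonnegative for \<open>p \<le> N\<close>, by \<open>p log p \<le> N log N\<close>,
  and nonpositive for \<open>p > N\<close>, by \<open>- log (1 - 1 / p) \<le> 1 / (p - 1) \<le> 1 / N\<close>.\<close>
lemma sum_over_primes_upper: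
  fixes Q :: "nat set"
  assumes N: "N \<ge> 2" and Q: "finite Q" "\<And>p. p \<in> Q \<Longrightarrow> prime p"
  shows "(\<Sum>p\<in>Q. - ln (1 - 1 / real p))
     \<le> (\<Sum>p | prime p \<and> p \<le> N. - ln (1 - 1 / real p) - ln p / (real N * ln N))
       + (\<Sum>p\<in>Q. ln (real p)) / (real N * ln N)"
proof -
  define P where "P = {p. prime p \<and> p \<le> N}"
  define h where "h = (\<lambda>p::nat. - ln (1 - 1 / real p) - ln p / (real N * ln N))"
  have lnN: "ln (real N) > 0" using N by simp
  have h_nonneg: "h p \<ge> 0" if "p \<in> P" for p
  proof -
    have p: "real p \<ge> 2" "p \<le> N" using that prime_ge_2_nat[of p] by (auto simp: P_def)
    have "ln (1 - 1 / real p) \<le> (1 - 1 / real p) - 1" using p by (intro ln_le_minus_one) auto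
    moreover have "real p * ln p \<le> real N * ln N" using p by (intro mult_mono) auto
    then have "ln p / (real N * ln N) \<le> 1 / real p" using p lnN N by (simp add: field_simps)
    ultimately show ?thesis by (simp add: h_def)
  qed
  have h_nonpos: "h p \<le> 0" if "p > N" for p
  proof -
    have p: "real p \<ge> real N + 1" "real N \<ge> 2" using that N by auto
    have "1 - 1 / real p = inverse (1 + 1 / (real p - 1))" using p by (simp add: field_simps)
    then have "- ln (1 - 1 / real p) = ln (1 + 1 / (real p - 1))" using p by (simp add: ln_inverse)
    also have "\<dots> \<le> 1 / (real p - 1)" using p by (intro ln_add_one_self_le_self) auto
    also have "\<dots> \<le> 1 / real N" using p by (intro divide_left_mono) auto
    also have "\<dots> = ln N / (real N * ln N)" using lnN by simp
    also have "\<dots> \<le> ln p / (real N * ln N)" using p lnN by (intro divide_right_mono) auto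
    finally show ?thesis by (simp add: h_def)
  qed
  have "(\<Sum>p\<in>Q. - ln (1 - 1 / real p)) = (\<Sum>p\<in>Q. h p) + (\<Sum>p\<in>Q. ln (real p)) / (real N * ln N)"
    unfolding h_def sum_divide_distrib sum.distrib[symmetric] by simp
  also have "(\<Sum>p\<in>Q. h p) = (\<Sum>p\<in>Q \<inter> P. h p) + (\<Sum>p\<in>Q - P. h p)"
    using Q by (metis add.commute sum.Int_Diff)
  also have "(\<Sum>p\<in>Q - P. h p) \<le> 0" using Q by (intro sum_nonpos h_nonpos) (auto simp: P_def)
  also have "(\<Sum>p\<in>Q \<inter> P. h p) \<le> (\<Sum>p\<in>P. h p)"
    by (rule sum_mono2) (auto simp: P_def[symmetric] h_nonneg, simp add: P_def)
  finally show ?thesis unfolding P_def h_def by simp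
qed

lemma sigma_div_mult_le:
  assumes "a > 0" "b > 0"
  shows "sigma_div (a * b) \<le> sigma_div a * sigma_div b"
proof -
  have "sigma_div (a * b) \<le> (\<Sum>d\<in>(\<lambda>(x,y). x * y) ` ({x. x dvd a} \<times> {y. y dvd b}). d)"
    unfolding sigma_div_def
  proof (rule sum_mono2)
    show "{d. d dvd a * b} \<subseteq> (\<lambda>(x,y). x * y) ` ({x. x dvd a} \<times> {y. y dvd b})"
    proof
      fix d assume "d \<in> {d. d dvd a * b}"
      then obtain x y where "d = x * y" "x dvd a" "y dvd b" using division_decomp by blast
      then show "d \<in> (\<lambda>(x,y). x * y) ` ({x. x dvd a} \<times> {y. y dvd b})" by force
    qed
  qed (use assms in auto)
  also have "\<dots> \<le> (\<Sum>(x,y)\<in>{x. x dvd a} \<times> {y. y dvd b}. x * y)"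
    using assms sum_image_le[of "{x. x dvd a} \<times> {y. y dvd b}" "\<lambda>d. d" "\<lambda>(x,y). x * y"]
    by (simp add: case_prod_unfold)
  also have "\<dots> = sigma_div a * sigma_div b"
    unfolding sigma_div_def by (simp add: sum_product sum.cartesian_product)
  finally show ?thesis .
qed

lemma sigma_div_prime_power_le:
  assumes p: "prime p"
  shows "real (sigma_div (p ^ a)) \<le> real (p ^ a) * (1 / (1 - 1 / real p))"
proof -
  have p1: "p > 1" using p by (rule prime_gt_1_nat)
  have "{d. d dvd p ^ a} = (\<lambda>i. p ^ i) ` {..a}" using p by (auto simp: divides_primepow_nat)
  then have "sigma_div (p ^ a) = (\<Sum>i\<le>a. p ^ i)"
    unfolding sigma_div_def using p1 by (simp add: sum.reindex inj_on_def)
  also have "real \<dots> = (real p ^ Suc a - 1) / (real p - 1)"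
    using p1 by (simp add: geometric_sum lessThan_Suc_atMost[symmetric] del: sum.lessThan_Suc)
  also have "\<dots> \<le> real p ^ Suc a / (real p - 1)" using p1 by (intro divide_right_mono) auto
  also have "\<dots> = real (p ^ a) * (1 / (1 - 1 / real p))" using p1 by (simp add: field_simps)
  finally show ?thesis .
qed

lemma sigma_div_prod_prime_powers_le:
  assumes "finite I" "\<And>k. k \<in> I \<Longrightarrow> prime (q k)"
  shows "real (sigma_div (\<Prod>k\<in>I. q k ^ a k)) \<le> real (\<Prod>k\<in>I. q k ^ a k) * (\<Prod>k\<in>I. 1 / (1 - 1 / real (q k)))"
  using assms
proof (induction I rule: finite_induct)
  case (insert j I)
  have pos: "(\<Prod>k\<in>I. q k ^ a k) > 0" "q j ^ a j > 0" 
    using insert by (auto intro!: prod_pos simp: prime_gt_0_nat)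
  have f: "1 / (1 - 1 / real (q j)) \<ge> 0" using insert.prems[of j] prime_gt_0_nat[of "q j"] by auto
  have "real (sigma_div (q j ^ a j * (\<Prod>k\<in>I. q k ^ a k))) \<le> real (sigma_div (q j ^ a j)) * real (sigma_div (\<Prod>k\<in>I. q k ^ a k))"
    using sigma_div_mult_le[OF pos(2,1)] by (metis of_nat_le_iff of_nat_mult)
  also have "\<dots> \<le> (real (q j ^ a j) * (1 / (1 - 1 / real (q j)))) * (real (\<Prod>k\<in>I. q k ^ a k) * (\<Prod>k\<in>I. 1 / (1 - 1 / real (q k))))"
    using insert f by (intro mult_mono sigma_div_prime_power_le) auto
  finally show ?case using insert by (simp add: mult_ac)
qed (simp add: sigma_div_def)

text \<open>After multiplication by \<open>log N\<close> the terms on the left other than \<open>log log N + \<gamma>\<close> have a sum tending to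
  \<open>(\<gamma> - 1) + 1 = \<gamma>\<close>, and the excess on the right tends to \<open>log 2\<close>; so the numerical fact
  \<open>\<gamma> < log 2\<close> decides.\<close>
lemma eventually_below_ln_ln_double:
  fixes B :: real
  shows "eventually (\<lambda>N::nat.
     ln (ln N) + euler_mascheroni + (euler_mascheroni - 1) / ln N + (1 + ln N) / (real N * ln N) + B / (ln (real N))\<^sup>2
       + 10 / sqrt N + (real N + 1) / (real N * ln N) < euler_mascheroni + ln (ln (2 * real N))) sequentially"
proof -
  define g :: real where "g = euler_mascheroni"
  have "g < ln 2" using euler_mascheroni_less_13_over_22 ln2_ge_two_thirds unfolding g_def by linarith
  then obtain c where c: "g < c" "c < ln 2" using dense by blast
  have "((\<lambda>N::nat. ln N * ((g - 1) / ln N + (1 + ln N) / (real N * ln N) + B / (ln (real N))\<^sup>2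
       + 10 / sqrt N + (real N + 1) / (real N * ln N))) \<longlongrightarrow> g) sequentially"
    by real_asymp
  moreover have "((\<lambda>N::nat. ln N * (ln (ln (2 * real N)) - ln (ln N))) \<longlongrightarrow> ln 2) sequentially"
    by real_asymp
  ultimately have "eventually (\<lambda>N::nat. ln N * ((g - 1) / ln N + (1 + ln N) / (real N * ln N) + B / (ln (real N))\<^sup>2
       + 10 / sqrt N + (real N + 1) / (real N * ln N)) < c \<and> c < ln N * (ln (ln (2 * real N)) - ln (ln N)) \<and> N \<ge> 2) sequentially"
    using c by (intro eventually_conj order_tendstoD eventually_ge_at_top)
  then show ?thesis unfolding g_def[symmetric]
  proof eventually_elim
    case (elim N)
    then have "ln (real N) * ((g - 1) / ln N + (1 + ln N) / (real N * ln N) + B / (ln (real N))\<^sup>2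
       + 10 / sqrt N + (real N + 1) / (real N * ln N)) < ln N * (ln (ln (2 * real N)) - ln (ln N))" by linarith
    then have "(g - 1) / ln N + (1 + ln N) / (real N * ln N) + B / (ln (real N))\<^sup>2
       + 10 / sqrt N + (real N + 1) / (real N * ln N) < ln (ln (2 * real N)) - ln (ln N)"
      by (rule mult_left_less_imp_less) (use elim in auto)
    then show ?case by linarith
  qed
qed

theorem mainTheorem3:
  shows "\<exists>A::real. A > 0 \<and>
    (\<forall>(n::nat) (m::nat) (q::nat \<Rightarrow> nat) (\<alpha>::nat \<Rightarrow> nat).
       m \<ge> 1 \<longrightarrow>
       (\<forall>k\<in>{1..m}. prime (q k)) \<longrightarrow>
       strict_mono_on {1..m} q \<longrightarrow>
       (\<forall>k\<in>{1..m}. \<alpha> k \<ge> 2) \<longrightarrow>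
       n = (\<Prod>k=1..m. q k ^ \<alpha> k) \<longrightarrow>
       real n \<ge> A \<longrightarrow>
       exp euler_mascheroni * real n * ln (ln (real n)) - real (sigma_div n) > 0)"
proof -
  define g :: real where "g = euler_mascheroni"
  obtain B where B: "\<And>N::nat. N \<ge> 2 \<Longrightarrow> mertens2 N - psi N / (real N * ln N)
     \<le> ln (ln N) + g + (g - 1) / ln N + (1 + ln N) / (real N * ln N) + B / (ln (real N))\<^sup>2"
    using mertens2_minus_psi_upper unfolding g_def by blast
  obtain N0 where N0: "\<And>N::nat. N \<ge> N0 \<Longrightarrow> 
     ln (ln N) + g + (g - 1) / ln N + (1 + ln N) / (real N * ln N) + B / (ln (real N))\<^sup>2
       + 10 / sqrt N + (real N + 1) / (real N * ln N) < g + ln (ln (2 * real N))"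
    using eventually_below_ln_ln_double[of B] unfolding g_def eventually_sequentially by blast
  define N1 where "N1 = max N0 2"
  have "exp g * real n * ln (ln (real n)) - real (sigma_div n) > 0"
    if q: "\<forall>k\<in>{1..m}. prime (q k)" and mono: "strict_mono_on {1..m} q"
      and \<alpha>: "\<forall>k\<in>{1..m}. \<alpha> k \<ge> 2" and n: "n = (\<Prod>k=1..m. q k ^ \<alpha> k)" 
      and large: "real n \<ge> exp (2 * real N1)" for n m :: nat and q \<alpha> :: "nat \<Rightarrow> nat"
  proof -
    define L where "L = ln (real n)"
    define N where "N = nat \<lfloor>L / 2\<rfloor>"
    define Q where "Q = q ` {1..m}"
    have n0: "real n > 0" using large by (rule less_le_trans[OF exp_gt_zero])
    have "L \<ge> 2 * real N1" unfolding L_def using large n0 by (subst ln_ge_iff) auto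
    then have L: "L / 2 \<ge> real N1" by simp
    then have "N \<ge> N1" unfolding N_def by (simp add: le_nat_floor)
    then have N: "N \<ge> 2" "N \<ge> N0" by (auto simp: N1_def)
    have "L / 2 \<ge> 1" using L by (simp add: N1_def)
    note fl = nat_floor_facts[OF this, folded N_def]
    have lnN: "ln (real N) > 0" using N by simp
    have inj: "inj_on q {1..m}" using mono by (rule strict_mono_on_imp_inj_on)
    have reindex: "(\<Sum>k=1..m. f (q k)) = (\<Sum>p\<in>Q. f p)" for f :: "nat \<Rightarrow> real"
      unfolding Q_def using inj by (simp add: sum.reindex)
    have Q: "finite Q" "\<And>p. p \<in> Q \<Longrightarrow> prime p" using q by (auto simp: Q_def)
    have q1: "real (q k) > 1" if "k \<in> {1..m}" for k using q that prime_gt_1_nat by auto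
    have "L = (\<Sum>k=1..m. ln (real (q k) ^ \<alpha> k))"
      unfolding L_def n of_nat_prod of_nat_power using q1 by (intro ln_prod) force+
    also have "\<dots> = (\<Sum>k=1..m. real (\<alpha> k) * ln (real (q k)))"
      using q1 by (intro sum.cong) (auto simp: ln_realpow)
    also have "\<dots> \<ge> (\<Sum>k=1..m. 2 * ln (real (q k)))"
    proof (intro sum_mono mult_right_mono)
      fix k assume k: "k \<in> {1..m}"
      show "2 \<le> real (\<alpha> k)" using \<alpha> k by auto
      show "0 \<le> ln (real (q k))" using q1[OF k] by simp
    qed
    finally have "2 * (\<Sum>p\<in>Q. ln (real p)) \<le> L"
      by (simp only: sum_distrib_left[symmetric] reindex[of "\<lambda>p. ln (real p)"])
    then have "(\<Sum>p\<in>Q. ln (real p)) \<le> L / 2" by simp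
    then have rad: "(\<Sum>p\<in>Q. ln (real p)) / (real N * ln N) \<le> (real N + 1) / (real N * ln N)"
      using fl lnN by (intro divide_right_mono) auto
    have pos: "1 / (1 - 1 / real (q k)) > 0" if "k \<in> {1..m}" for k
      using q1[OF that] by simp
    define E where "E = (\<Prod>k=1..m. 1 / (1 - 1 / real (q k)))"
    have E: "E > 0" unfolding E_def using pos by (intro prod_pos) auto
    have "ln E = (\<Sum>k=1..m. ln (1 / (1 - 1 / real (q k))))"
      unfolding E_def by (rule ln_prod[OF finite_atLeastAtMost]) (use pos in \<open>metis less_irrefl\<close>)
    also have "\<dots> = (\<Sum>k=1..m. - ln (1 - 1 / real (q k)))"
      using q1 by (intro sum.cong) (auto simp: ln_div)
    also have "\<dots> = (\<Sum>p\<in>Q. - ln (1 - 1 / real p))" by (rule reindex)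
    also have "\<dots> \<le> (\<Sum>p | prime p \<and> p \<le> N. - ln (1 - 1 / real p) - ln p / (real N * ln N))
       + (\<Sum>p\<in>Q. ln (real p)) / (real N * ln N)"
      by (rule sum_over_primes_upper[OF N(1) Q])
    also have "\<dots> < g + ln (ln (2 * real N))"
      using mertens_product_vs_mertens2[OF N(1)] B[OF N(1)] N0[OF N(2)] rad by linarith
    finally have "ln E < g + ln (ln (2 * real N))" .
    also have "ln (ln (2 * real N)) \<le> ln (ln L)"
      using fl(2) N(1) by (subst ln_le_cancel_iff) auto
    finally have lnE: "ln E < g + ln (ln L)" by simp
    have "L \<ge> 4" using fl(2) N(1) by linarith
    then have lnL: "ln L > 0" by simp
    have "E = exp (ln E)" using E by simp
    also have "\<dots> < exp (g + ln (ln L))" using lnE by simp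
    also have "\<dots> = exp g * ln L" using lnL by (simp add: exp_add)
    finally have "E < exp g * ln L" .
    then have "real n * E < real n * (exp g * ln L)" using n0 by simp
    moreover have "real (sigma_div n) \<le> real n * E"
      unfolding n E_def using q by (intro sigma_div_prod_prime_powers_le) auto
    ultimately show ?thesis unfolding L_def by (simp add: mult_ac)
  qed
  then show ?thesis unfolding g_def
    by (intro exI[of _ "exp (2 * real N1)"] conjI exp_gt_zero allI impI) blast
qed

end
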